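(* Let $m$ be an odd positive integer, $k\ge0$ an integer, $N=k+\frac{m-1}{2}$, $\alpha\in\mathbb R$, and let $P_k(\underline x)$ be an $\mathbb R_{0,m}$-valued homogeneous polynomial of degree $k$ on $\mathbb R^m$ with $\partial_{\underline x}P_k=0$. Then \[\mathsf{Ft}\left[\left(1+z^2\right)^{\alpha+N},P_k(\underline x)\right](x_0,\underline x)=(-2)^{N}(2k+m-1)!!\left(\prod_{j=1}^{N}(\alpha+j)\right)\mathsf{CK}\left[\left(1-|\underline x|^2\right)^\alpha P_k(\underline x)\right](x_0,\underline x).\]
   Context: $\mathbb R_{0,m}$ is the real Clifford algebra generated by $e_1,\dots,e_m$ with $e_je_k+e_ke_j=-2\delta_{jk}$; $\underline x\in\mathbb R^m$ is identified with $\sum_j x_je_j$. Write $r=|\underline x|$, $\underline\omega=\underline x/r$; points of $\mathbb R^{m+1}$ are $(x_0,\underline x)$. Dirac operator $\partial_{\underline x}=\sum_{j=1}^m e_j\partial_{x_j}$; a $C^1$ $\mathbb R_{0,m}$-valued function $f$ on an open subset of $\mathbb R^{m+1}$ is monogenic if $(\partial_{x_0}+\partial_{\underline x})f=0$. For $g$ real-analytic and $\mathbb R_{0,m}$-valued on an open $\underline\Omega\subset\mathbb R^m$, $\mathsf{CK}[g](x_0,\underline x)=\sum_{n\ge0}\frac{(-x_0)^n}{n!}\partial_{\underline x}^ng(\underline x)$ is its unique monogenic extension to a neighbourhood of $\underline\Omega$ in $\mathbb R^{m+1}$; here $g=(1-|\underline x|^2)^\alpha P_k$ on $|\underline x|<1$.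 Fueter map: for $h(z)=u(x,y)+iv(x,y)$ holomorphic on an open subset $\Xi$ of the upper half plane, $\mathsf{Ft}[h(z),P_k(\underline x)](x_0,\underline x)=\Delta^{k+\frac{m-1}{2}}[(u(x_0,r)+\underline\omega\,v(x_0,r))P_k(\underline x)]$ with $\Delta=\sum_{j=0}^m\partial_{x_j}^2$, defined where $(x_0,r)\in\Xi$. The power $(1+z^2)^{\gamma}$ with real exponent is the principal branch, given for $|z|<1$ by the binomial series $\sum_{n\ge0}\binom{\gamma}{n}z^{2n}$; the identity is understood near points $(0,\underline x)$ with $0<|\underline x|<1$. Double factorials use $(-1)!!=0!!=1$. *)

theory Defs
  imports "HOL-Analysis.Analysis"
begin

text \<open>An element of the Clifford algebra is represented by its coordinates with respect
  to the basis blades e_A, A a finite set of generator indices (e_{} = 1, e_{j} = e_j).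
  Elements of R_{0,m} are those supported on subsets of {1..m}.\<close>

type_synonym cliff = "nat set \<Rightarrow> real"

text \<open>Sign of e_S e_T = csign S T * e_(S symmetric-difference T), using e_j e_j = -1 and
  anticommutation of distinct generators.\<close>
definition csign :: "nat set \<Rightarrow> nat set \<Rightarrow> real" where
  "csign S T = (-1) ^ (card {(s, t). s \<in> S \<and> t \<in> T \<and> t < s} + card (S \<inter> T))"

definition cmul :: "cliff \<Rightarrow> cliff \<Rightarrow> cliff" where
  "cmul a b = (\<lambda>C. \<Sum>S\<in>{S. a S \<noteq> 0}. a S * b ((S - C) \<union> (C - S)) * csign S ((S - C) \<union> (C - S)))"

definition cscal :: "real \<Rightarrow> cliff" where
  "cscal c = (\<lambda>C. if C = {} then c else 0)"

definition cgen :: "nat \<Rightarrow> cliff" where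
  "cgen j = (\<lambda>C. if C = {j} then 1 else 0)"

definition in_Rm :: "nat \<Rightarrow> cliff \<Rightarrow> bool" where
  "in_Rm m a \<longleftrightarrow> (\<forall>C. a C \<noteq> 0 \<longrightarrow> C \<subseteq> {1..m})"

text \<open>A point (x_0, x_1, ..., x_m) of R^{m+1} is a function p :: nat => real; only the
  coordinates 0..m are used. The vector part underline x = sum_{j=1}^m x_j e_j.\<close>

definition cvec :: "nat \<Rightarrow> (nat \<Rightarrow> real) \<Rightarrow> cliff" where
  "cvec m p = (\<lambda>C. \<Sum>j\<in>{1..m}. if C = {j} then p j else 0)"

definition rad :: "nat \<Rightarrow> (nat \<Rightarrow> real) \<Rightarrow> real" where
  "rad m p = sqrt (\<Sum>j\<in>{1..m}. (p j)\<^sup>2)"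

definition cpartial :: "nat \<Rightarrow> ((nat \<Rightarrow> real) \<Rightarrow> cliff) \<Rightarrow> (nat \<Rightarrow> real) \<Rightarrow> cliff" where
  "cpartial j f p = (\<lambda>C. deriv (\<lambda>t. f (p(j := t)) C) (p j))"

definition dirac :: "nat \<Rightarrow> ((nat \<Rightarrow> real) \<Rightarrow> cliff) \<Rightarrow> (nat \<Rightarrow> real) \<Rightarrow> cliff" where
  "dirac m f p = (\<lambda>C. \<Sum>j\<in>{1..m}. cmul (cgen j) (cpartial j f p) C)"

definition lap :: "nat \<Rightarrow> ((nat \<Rightarrow> real) \<Rightarrow> cliff) \<Rightarrow> (nat \<Rightarrow> real) \<Rightarrow> cliff" where
  "lap m f p = (\<lambda>C. \<Sum>j\<in>{0..m}. cpartial j (cpartial j f) p C)"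

definition multi_idx :: "nat \<Rightarrow> nat \<Rightarrow> (nat \<Rightarrow> nat) set" where
  "multi_idx m k = {\<beta>. (\<forall>j. j \<notin> {1..m} \<longrightarrow> \<beta> j = 0) \<and> (\<Sum>j\<in>{1..m}. \<beta> j) = k}"

definition hom_poly :: "nat \<Rightarrow> nat \<Rightarrow> ((nat \<Rightarrow> real) \<Rightarrow> cliff) \<Rightarrow> bool" where
  "hom_poly m k P \<longleftrightarrow> (\<forall>x. in_Rm m (P x)) \<and>
     (\<forall>C. \<exists>c :: (nat \<Rightarrow> nat) \<Rightarrow> real. \<forall>x.
         P x C = (\<Sum>\<beta>\<in>multi_idx m k. c \<beta> * (\<Prod>j\<in>{1..m}. x j ^ \<beta> j)))"

definition CK :: "nat \<Rightarrow> ((nat \<Rightarrow> real) \<Rightarrow> cliff) \<Rightarrow> (nat \<Rightarrow> real) \<Rightarrow> cliff" where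
  "CK m g p = (\<lambda>C. \<Sum>n. (- p 0) ^ n / fact n * ((dirac m ^^ n) g p) C)"

definition Ft :: "nat \<Rightarrow> nat \<Rightarrow> (complex \<Rightarrow> complex) \<Rightarrow> ((nat \<Rightarrow> real) \<Rightarrow> cliff)
                  \<Rightarrow> (nat \<Rightarrow> real) \<Rightarrow> cliff" where
  "Ft m k h P = (lap m ^^ (k + (m - 1) div 2))
     (\<lambda>p. let z = Complex (p 0) (rad m p) in
        cmul (\<lambda>C. cscal (Re (h z)) C + cvec m p C / rad m p * Im (h z)) (P p))"

fun dfact :: "nat \<Rightarrow> nat" where
  "dfact 0 = 1"
| "dfact (Suc 0) = 1"
| "dfact (Suc (Suc n)) = Suc (Suc n) * dfact n"

end

theory Submission
  imports Defs "HOL-Complex_Analysis.Complex_Analysis"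
begin

text \<open>Put \<open>s = |x|\<^sup>2\<close>. Since \<open>P\<close> and \<open>x P\<close> are homogeneous and harmonic, the Laplacian acts on fields
  \<open>a(x\<^sub>0, s) P + b(x\<^sub>0, s) x P\<close> through second-order operators in \<open>(x\<^sub>0, s)\<close>. For \<open>a = Re h(x\<^sub>0 + i r)\<close> and
  \<open>b = Im h(x\<^sub>0 + i r) / r\<close>, the Cauchy--Riemann equations turn the Laplacian of the field with
  coefficients \<open>\<partial>\<^sub>s\<^sup>n a\<close>, \<open>\<partial>\<^sub>s\<^sup>n b\<close> into \<open>4 (N - n)\<close> times the field with coefficients \<open>\<partial>\<^sub>s\<^bsup>n+1\<^esup> a\<close>, \<open>\<partial>\<^sub>s\<^bsup>n+1\<^esup> b\<close>.
  Hence the Fueter map produces \<open>4\<^sup>N N!\<close> times the field with coefficients \<open>\<partial>\<^sub>s\<^sup>N a\<close>, \<open>\<partial>\<^sub>s\<^sup>N b\<close>. The same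
  equations say that this field is monogenic, so its Taylor series in \<open>x\<^sub>0\<close> is the CK series of its value
  at \<open>x\<^sub>0 = 0\<close>, which for \<open>h = (1 + z\<^sup>2)\<^bsup>\<alpha>+N\<^esup>\<close> is \<open>\<partial>\<^sub>s\<^sup>N (1 - s)\<^bsup>\<alpha>+N\<^esup> P\<close>.\<close>

text \<open>As a simp rule, this would rewrite the index set \<open>{1..m}\<close> to \<open>{Suc 0..m}\<close>.\<close>

declare One_nat_def [simp del]

section \<open>Left multiplication by the Clifford generators on blade coordinates\<close>

definition flip :: "nat \<Rightarrow> nat set \<Rightarrow> nat set" where
  "flip j C = ({j} - C) \<union> (C - {j})"

definition flip_sign :: "nat \<Rightarrow> nat set \<Rightarrow> real" where
  "flip_sign j C = csign {j} (flip j C)"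

text \<open>The product of e_j with e_S is a multiple of e_C exactly for
  \<open>S = flip j C\<close>, so left multiplication by e_j is a signed permutation of
  coordinates.\<close>

definition gen_mul :: "nat \<Rightarrow> cliff \<Rightarrow> cliff" where
  "gen_mul j a = (\<lambda>C. flip_sign j C * a (flip j C))"

lemma cmul_cgen: "cmul (cgen j) a = gen_mul j a"
proof -
  have "{S. cgen j S \<noteq> 0} = {{j}}" by (auto simp: cgen_def)
  then show ?thesis
    by (simp add: cmul_def gen_mul_def fun_eq_iff flip_sign_def flip_def cgen_def)
qed

lemma flip_flip [simp]: "flip j (flip j C) = C"
  by (auto simp: flip_def)

lemma flip_commute: "flip i (flip j C) = flip j (flip i C)"
  by (auto simp: flip_def)

text \<open>Each smaller generator passed costs a sign, and e_j e_j = -1 costs another when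
  \<open>j\<close> lies in \<open>flip j C\<close>, that is, when \<open>j\<close> is not in
  \<open>C\<close>. Only indices below \<open>j\<close> are counted, so infinite \<open>C\<close>
  cause no trouble.\<close>

lemma flip_sign_eq:
  "flip_sign j C = (-1) ^ card {t \<in> C. t < j} * (if j \<in> C then 1 else -1)"
proof -
  have "{(s, t). s \<in> {j} \<and> t \<in> flip j C \<and> t < s} = Pair j ` {t \<in> C. t < j}"
    by (auto simp: flip_def)
  then have "card {(s, t). s \<in> {j} \<and> t \<in> flip j C \<and> t < s} = card {t \<in> C. t < j}"
    by (simp add: card_image inj_on_def)
  moreover have "{j} \<inter> flip j C = (if j \<in> C then {} else {j})"
    by (auto simp: flip_def)
  ultimately show ?thesis
    by (simp add: flip_sign_def csign_def)
qed

lemma flip_sign_same: "flip_sign j C * flip_sign j (flip j C) = -1"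
proof -
  have "{t \<in> flip j C. t < j} = {t \<in> C. t < j}" by (auto simp: flip_def)
  moreover have "j \<in> flip j C \<longleftrightarrow> j \<notin> C" by (auto simp: flip_def)
  ultimately show ?thesis by (simp add: flip_sign_eq power_mult_distrib[symmetric])
qed

lemma sign_card_flip:
  assumes "i \<noteq> j"
  shows "(-1::real) ^ card {t \<in> flip i C. t < j} = (if i < j then -1 else 1) * (-1) ^ card {t \<in> C. t < j}"
proof (cases "i < j")
  case False
  then have "{t \<in> flip i C. t < j} = {t \<in> C. t < j}" by (auto simp: flip_def)
  then show ?thesis using False by simp
next
  case True
  define A where "A = {t \<in> C. t < j} - {i}"
  have ins: "card (insert i A) = Suc (card A)"
    by (rule card_insert_disjoint) (auto simp: A_def)
  show ?thesis
  proof (cases "i \<in> C")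
    case iC: True
    have "{t \<in> flip i C. t < j} = A" "{t \<in> C. t < j} = insert i A"
      using True iC by (auto simp: flip_def A_def)
    then show ?thesis using ins True by simp
  next
    case iC: False
    have "{t \<in> flip i C. t < j} = insert i A" "{t \<in> C. t < j} = A"
      using True iC by (auto simp: flip_def A_def)
    then show ?thesis using ins True by simp
  qed
qed

text \<open>Exactly one of \<open>i < j\<close> and \<open>j < i\<close> holds, so by
  \<open>sign_card_flip\<close> exactly one of the two parities changes.\<close>

lemma flip_sign_anticommute:
  assumes "i \<noteq> j"
  shows "flip_sign i C * flip_sign j (flip i C) = - (flip_sign j C * flip_sign i (flip j C))"
proof -
  have "j \<in> flip i C \<longleftrightarrow> j \<in> C" "i \<in> flip j C \<longleftrightarrow> i \<in> C" using assms by (auto simp: flip_def)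
  then show ?thesis
    using assms sign_card_flip[of i j C] sign_card_flip[of j i C]
    by (simp add: flip_sign_eq)
qed

lemma gen_mul_same: "gen_mul j (gen_mul j a) = (\<lambda>C. - a C)"
  using flip_sign_same by (simp add: gen_mul_def fun_eq_iff mult.assoc[symmetric])

lemma gen_mul_anticommute:
  assumes "i \<noteq> j"
  shows "gen_mul i (gen_mul j a) C = - gen_mul j (gen_mul i a) C"
  using flip_sign_anticommute[OF assms, of C] by (simp add: gen_mul_def mult.assoc[symmetric] flip_commute)

lemma gen_mul_relation:
  "gen_mul i (gen_mul j a) C + gen_mul j (gen_mul i a) C = (if i = j then - 2 * a C else 0)"
  using gen_mul_anticommute[of i j a C] by (auto simp: gen_mul_same)

lemma gen_mul_sum: "gen_mul j (\<lambda>C. \<Sum>i\<in>I. f i C) = (\<lambda>C. \<Sum>i\<in>I. gen_mul j (f i) C)"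
  by (simp add: gen_mul_def sum_distrib_left)

lemma gen_mul_add: "gen_mul j (\<lambda>C. a C + b C) C = gen_mul j a C + gen_mul j b C"
  by (simp add: gen_mul_def algebra_simps)

lemma gen_mul_scale: "gen_mul j (\<lambda>C. c * a C) C = c * gen_mul j a C"
  by (simp add: gen_mul_def)

lemma gen_mul_zero [simp]: "gen_mul j (\<lambda>C. 0) C = 0"
  by (simp add: gen_mul_def)

text \<open>Off-diagonal terms cancel in pairs by anticommutation. With second partial derivatives
  as \<open>A\<close>, the square of the Dirac operator is minus the Laplacian; with products of
  coordinates, a vector squares to minus its squared length.\<close>

lemma sum_gen_mul_symmetric:
  assumes "finite I" and sym: "\<And>i j. A i j = A j i"
  shows "(\<Sum>i\<in>I. \<Sum>j\<in>I. gen_mul i (gen_mul j (A i j)) C) = - (\<Sum>i\<in>I. A i i C)"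
proof -
  let ?S = "\<Sum>i\<in>I. \<Sum>j\<in>I. gen_mul i (gen_mul j (A i j)) C"
  have "?S = (\<Sum>i\<in>I. \<Sum>j\<in>I. gen_mul j (gen_mul i (A i j)) C)"
    by (subst sum.swap) (simp add: sym)
  then have "2 * ?S = (\<Sum>i\<in>I. \<Sum>j\<in>I. gen_mul i (gen_mul j (A i j)) C + gen_mul j (gen_mul i (A i j)) C)"
    by (simp add: sum.distrib)
  also have "\<dots> = (\<Sum>i\<in>I. - 2 * A i i C)"
    using assms(1) by (simp add: gen_mul_relation sum.delta)
  finally show ?thesis by (simp add: sum_negf sum_distrib_left[symmetric])
qed

lemma cmul_cscal: "cmul (cscal c) a = (\<lambda>C. c * a C)"
proof (cases "c = 0")
  case False
  then have "{S. cscal c S \<noteq> 0} = {{}}" by (auto simp: cscal_def)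
  then show ?thesis by (simp add: cmul_def cscal_def csign_def fun_eq_iff)
qed (simp add: cmul_def cscal_def)

lemma cvec_singleton: "j \<in> {1..m} \<Longrightarrow> cvec m p {j} = p j"
  by (simp add: cvec_def)

text \<open>A paravector is supported on the empty set and singletons, so the sum over the support
  in \<open>cmul\<close> may run over these blades, the added terms being zero.\<close>

lemma cmul_paravector:
  "cmul (\<lambda>C. cscal a C + b * cvec m p C) Q C = a * Q C + b * (\<Sum>j\<in>{1..m}. p j * gen_mul j Q C)"
proof -
  let ?w = "\<lambda>C. cscal a C + b * cvec m p C"
  let ?B = "insert {} ((\<lambda>j. {j}) ` {1..m})"
  let ?t = "\<lambda>S. ?w S * Q ((S - C) \<union> (C - S)) * csign S ((S - C) \<union> (C - S))"
  have w0: "?w S = 0" if "S \<notin> ?B" for S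
  proof -
    have "S \<noteq> {}" "\<And>j. j \<in> {1..m} \<Longrightarrow> S \<noteq> {j}" using that by auto
    then have "cscal a S = 0" "cvec m p S = 0"
      by (auto simp: cscal_def cvec_def intro!: sum.neutral)
    then show ?thesis by simp
  qed
  have "cmul ?w Q C = (\<Sum>S\<in>?B. ?t S)"
    unfolding cmul_def using w0 by (intro sum.mono_neutral_left) auto
  also have "\<dots> = ?t {} + (\<Sum>j\<in>{1..m}. ?t {j})"
    by (subst sum.insert) (auto simp: sum.reindex inj_on_def)
  also have "?t {} = a * Q C"
    by (simp add: cscal_def cvec_def csign_def)
  also have "(\<Sum>j\<in>{1..m}. ?t {j}) = (\<Sum>j\<in>{1..m}. b * (p j * gen_mul j Q C))"
    by (intro sum.cong) (auto simp: cscal_def cvec_singleton gen_mul_def flip_sign_def flip_def)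
  finally show ?thesis by (simp add: sum_distrib_left)
qed

section \<open>Monomials and monogenic homogeneous polynomials\<close>

definition monomial :: "nat \<Rightarrow> (nat \<Rightarrow> nat) \<Rightarrow> (nat \<Rightarrow> real) \<Rightarrow> real" where
  "monomial m \<beta> x = (\<Prod>j\<in>{1..m}. x j ^ \<beta> j)"

lemma monomial_split:
  "i \<in> {1..m} \<Longrightarrow> monomial m \<beta> x = x i ^ \<beta> i * (\<Prod>j\<in>{1..m} - {i}. x j ^ \<beta> j)"
  unfolding monomial_def by (subst prod.remove[of _ i]) auto

text \<open>If \<open>\<beta> i = 0\<close>, truncated subtraction leaves the exponent 0, and the
  factor \<open>real (\<beta> i)\<close> makes the right-hand side zero as it should be.\<close>

lemma monomial_has_partial:
  assumes "i \<in> {1..m}"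
  shows "((\<lambda>t. monomial m \<beta> (x(i := t))) has_real_derivative
           real (\<beta> i) * monomial m (\<beta>(i := \<beta> i - 1)) x) (at (x i))"
proof -
  let ?R = "\<Prod>j\<in>{1..m} - {i}. x j ^ \<beta> j"
  have "monomial m \<beta> (x(i := t)) = t ^ \<beta> i * ?R" for t
    by (subst monomial_split[OF assms]) (auto intro!: prod.cong)
  moreover have "monomial m (\<beta>(i := \<beta> i - 1)) x = x i ^ (\<beta> i - 1) * ?R"
    by (subst monomial_split[OF assms]) (auto intro!: prod.cong)
  ultimately show ?thesis
    by (auto intro!: derivative_eq_intros simp: One_nat_def)
qed

lemma monomial_Euler:
  assumes "i \<in> {1..m}"
  shows "x i * (real (\<beta> i) * monomial m (\<beta>(i := \<beta> i - 1)) x) = real (\<beta> i) * monomial m \<beta> x"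
proof (cases "\<beta> i")
  case (Suc n)
  have "(\<Prod>j\<in>{1..m} - {i}. x j ^ (\<beta>(i := n)) j) = (\<Prod>j\<in>{1..m} - {i}. x j ^ \<beta> j)"
    by (auto intro!: prod.cong)
  then show ?thesis
    by (simp add: monomial_split[OF assms] Suc)
qed simp

text \<open>Interface to \<open>P\<close> through explicit partial derivatives, so that later
  arguments rest on symmetry, Euler's identity and monogenicity instead of coefficients.\<close>

locale monogenic_poly =
  fixes m k :: nat
    and P :: "(nat \<Rightarrow> real) \<Rightarrow> cliff"
    and P1 :: "nat \<Rightarrow> (nat \<Rightarrow> real) \<Rightarrow> cliff"
    and P2 :: "nat \<Rightarrow> nat \<Rightarrow> (nat \<Rightarrow> real) \<Rightarrow> cliff"
  assumes P_time: "P (x(0 := t)) = P x"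
    and P_has_partial: "\<And>i x C. i \<in> {1..m} \<Longrightarrow>
          ((\<lambda>t. P (x(i := t)) C) has_real_derivative P1 i x C) (at (x i))"
    and P1_has_partial: "\<And>i j x C. j \<in> {1..m} \<Longrightarrow>
          ((\<lambda>t. P1 i (x(j := t)) C) has_real_derivative P2 i j x C) (at (x j))"
    and P2_sym: "\<And>i j x. P2 i j x = P2 j i x"
    and Euler: "\<And>x C. (\<Sum>i\<in>{1..m}. x i * P1 i x C) = real k * P x C"
    and P_monogenic: "\<And>x C. (\<Sum>j\<in>{1..m}. gen_mul j (P1 j x) C) = 0"

lemma hom_poly_monogenic_poly:
  assumes hom: "hom_poly m k P" and mon: "\<And>x. dirac m P x = (\<lambda>C. 0)"
  obtains P1 P2 where "monogenic_poly m k P P1 P2"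
proof -
  let ?M = "multi_idx m k"
  have "\<forall>C. \<exists>c. \<forall>x. P x C = (\<Sum>\<beta>\<in>?M. c \<beta> * monomial m \<beta> x)"
    using hom by (simp add: hom_poly_def monomial_def)
  then obtain c where c: "\<And>C x. P x C = (\<Sum>\<beta>\<in>?M. c C \<beta> * monomial m \<beta> x)"
    by metis
  define P1 :: "nat \<Rightarrow> (nat \<Rightarrow> real) \<Rightarrow> cliff" where
    "P1 i x C = (\<Sum>\<beta>\<in>?M. c C \<beta> * (real (\<beta> i) * monomial m (\<beta>(i := \<beta> i - 1)) x))" for i x C
  define P2 :: "nat \<Rightarrow> nat \<Rightarrow> (nat \<Rightarrow> real) \<Rightarrow> cliff" where
    "P2 i j x C = (\<Sum>\<beta>\<in>?M. c C \<beta> * (real (\<beta> i) * (real ((\<beta>(i := \<beta> i - 1)) j) *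
        monomial m ((\<beta>(i := \<beta> i - 1))(j := (\<beta>(i := \<beta> i - 1)) j - 1)) x)))" for i j x C
  have P1: "((\<lambda>t. P (x(i := t)) C) has_real_derivative P1 i x C) (at (x i))" if "i \<in> {1..m}" for i x C
    unfolding c P1_def by (intro DERIV_sum DERIV_cmult monomial_has_partial that)
  have "monogenic_poly m k P P1 P2"
  proof
    show "P (x(0 := t)) = P x" for x t
      by (auto simp: c monomial_def fun_eq_iff intro!: sum.cong prod.cong)
    show "((\<lambda>t. P (x(i := t)) C) has_real_derivative P1 i x C) (at (x i))" if "i \<in> {1..m}" for i x C
      by (rule P1[OF that])
    show "((\<lambda>t. P1 i (x(j := t)) C) has_real_derivative P2 i j x C) (at (x j))"
      if "j \<in> {1..m}" for i j x C
      unfolding P1_def P2_def by (intro DERIV_sum DERIV_cmult monomial_has_partial that)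
    show "P2 i j x = P2 j i x" for i j x
    proof (cases "i = j")
      case False
      then show ?thesis
        by (simp add: P2_def fun_eq_iff fun_upd_twist[OF False] mult_ac)
    qed simp
    show "(\<Sum>i\<in>{1..m}. x i * P1 i x C) = real k * P x C" for x C
    proof -
      \<comment> \<open>In direction \<open>i\<close> the Euler operator multiplies each monomial by
        \<open>\<beta> i\<close>, and the exponents of a multi-index in \<open>?M\<close> add up to
        \<open>k\<close>.\<close>
      have "(\<Sum>i\<in>{1..m}. x i * P1 i x C)
          = (\<Sum>\<beta>\<in>?M. \<Sum>i\<in>{1..m}. c C \<beta> * (x i * (real (\<beta> i) * monomial m (\<beta>(i := \<beta> i - 1)) x)))"
        unfolding P1_def sum_distrib_left by (subst sum.swap) (simp add: mult_ac)
      also have "\<dots> = (\<Sum>\<beta>\<in>?M. \<Sum>i\<in>{1..m}. c C \<beta> * (real (\<beta> i) * monomial m \<beta> x))"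
        by (intro sum.cong refl) (simp add: monomial_Euler)
      also have "\<dots> = (\<Sum>\<beta>\<in>?M. real (\<Sum>i\<in>{1..m}. \<beta> i) * (c C \<beta> * monomial m \<beta> x))"
        by (simp add: sum_distrib_right sum_distrib_left mult_ac)
      also have "\<dots> = real k * P x C"
        unfolding c sum_distrib_left by (intro sum.cong) (auto simp: multi_idx_def)
      finally show ?thesis .
    qed
    show "(\<Sum>j\<in>{1..m}. gen_mul j (P1 j x) C) = 0" for x C
    proof -
      have "cpartial j P x = P1 j x" if "j \<in> {1..m}" for j
        using P1[OF that] by (auto simp: cpartial_def fun_eq_iff intro: DERIV_imp_deriv)
      then have "(\<Sum>j\<in>{1..m}. gen_mul j (P1 j x) C) = dirac m P x C"
        unfolding dirac_def cmul_cgen by (intro sum.cong refl) simp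
      then show ?thesis by (simp add: mon)
    qed
  qed
  then show ?thesis by (rule that)
qed

section \<open>Differential calculus of the fields a(s) P + b(s) x P\<close>

definition rsq :: "nat \<Rightarrow> (nat \<Rightarrow> real) \<Rightarrow> real" where
  "rsq m p = (\<Sum>j\<in>{1..m}. (p j)\<^sup>2)"

lemma rsq_nonneg: "0 \<le> rsq m p"
  by (simp add: rsq_def sum_nonneg)

lemma rad_eq_sqrt: "rad m p = sqrt (rsq m p)"
  by (simp add: rad_def rsq_def)

lemma rad_power2: "(rad m p)\<^sup>2 = rsq m p"
  by (simp add: rad_eq_sqrt rsq_nonneg)

lemma rsq_time [simp]: "rsq m (p(0 := t)) = rsq m p"
  by (auto simp: rsq_def intro!: sum.cong)

lemma rsq_has_partial:
  assumes "i \<in> {1..m}"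
  shows "((\<lambda>t. rsq m (p(i := t))) has_real_derivative 2 * t) (at t)"
proof -
  have "rsq m (p(i := t)) = t\<^sup>2 + (\<Sum>j\<in>{1..m} - {i}. (p j)\<^sup>2)" for t
    unfolding rsq_def using assms by (subst sum.remove[of _ i]) auto
  then show ?thesis
    by (auto intro!: derivative_eq_intros)
qed

lemma eventually_rsq:
  assumes "i \<in> {1..m}" "open S" "rsq m p \<in> S"
  shows "\<forall>\<^sub>F t in nhds (p i). rsq m (p(i := t)) \<in> S"
proof -
  have "isCont (\<lambda>t. rsq m (p(i := t))) (p i)"
    by (rule DERIV_isCont[OF rsq_has_partial[OF assms(1)]])
  then show ?thesis
    using assms by (simp add: isCont_def tendsto_def eventually_nhds_conv_at)
qed

text \<open>With \<open>a0\<close>, \<open>a1\<close>, \<open>a2\<close> the value and first two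
  derivatives of a function at |x|^2, the summand is the second partial derivative of its product
  with \<open>f\<close>. Euler's identity evaluates the cross terms; harmonicity removes the
  \<open>a0\<close> terms.\<close>

lemma sum_scalar_second_partials:
  fixes f :: real and f1 f2 :: "nat \<Rightarrow> real"
  assumes "(\<Sum>i\<in>{1..m}. p i * f1 i) = d * f" and "(\<Sum>i\<in>{1..m}. f2 i) = 0"
  shows "(\<Sum>i\<in>{1..m}. (2 * a1 + 4 * (p i)\<^sup>2 * a2) * f + 4 * p i * a1 * f1 i + a0 * f2 i)
    = (4 * rsq m p * a2 + (2 * real m + 4 * d) * a1) * f"
proof -
  have "(\<Sum>i\<in>{1..m}. (2 * a1 + 4 * (p i)\<^sup>2 * a2) * f + 4 * p i * a1 * f1 i + a0 * f2 i)
    = 2 * real m * a1 * f + 4 * a2 * f * rsq m p + 4 * a1 * (\<Sum>i\<in>{1..m}. p i * f1 i)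
      + a0 * (\<Sum>i\<in>{1..m}. f2 i)"
    by (simp add: sum.distrib sum_distrib_left rsq_def algebra_simps)
  then show ?thesis
    unfolding assms by (simp add: algebra_simps)
qed

context monogenic_poly
begin

text \<open>Differentiating \<open>P_monogenic\<close> and applying the generators once more gives
  the squared Dirac operator of \<open>P\<close>, which is minus its Laplacian.\<close>

lemma P_harmonic: "(\<Sum>i\<in>{1..m}. P2 i i x C) = 0"
proof -
  have 0: "(\<Sum>j\<in>{1..m}. gen_mul j (P2 j i x) C) = 0" if i: "i \<in> {1..m}" for i C
  proof -
    have "((\<lambda>t. \<Sum>j\<in>{1..m}. gen_mul j (P1 j (x(i := t))) C) has_real_derivative
            (\<Sum>j\<in>{1..m}. gen_mul j (P2 j i x) C)) (at (x i))"
      unfolding gen_mul_def by (intro DERIV_sum DERIV_cmult P1_has_partial i)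
    then show ?thesis
      unfolding P_monogenic using DERIV_unique[OF _ DERIV_const] by blast
  qed
  have "(\<Sum>i\<in>{1..m}. gen_mul i (\<lambda>C. \<Sum>j\<in>{1..m}. gen_mul j (P2 j i x) C) C) = 0"
    by (simp add: 0)
  then have "(\<Sum>i\<in>{1..m}. \<Sum>j\<in>{1..m}. gen_mul i (gen_mul j (P2 i j x)) C) = 0"
    by (simp add: gen_mul_sum P2_sym)
  then show ?thesis
    using sum_gen_mul_symmetric[of "{1..m}" "\<lambda>i j. P2 i j x" C] P2_sym by simp
qed

text \<open>\<open>X\<close> is the Clifford product of the vector variable with \<open>P\<close>;
  \<open>X1\<close> and \<open>X2\<close> are its first and pure second partial derivatives by the
  product rule.\<close>

definition X :: "(nat \<Rightarrow> real) \<Rightarrow> cliff" where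
  "X x = (\<lambda>C. \<Sum>j\<in>{1..m}. x j * gen_mul j (P x) C)"

definition X1 :: "nat \<Rightarrow> (nat \<Rightarrow> real) \<Rightarrow> cliff" where
  "X1 i x = (\<lambda>C. gen_mul i (P x) C + (\<Sum>j\<in>{1..m}. x j * gen_mul j (P1 i x) C))"

definition X2 :: "nat \<Rightarrow> (nat \<Rightarrow> real) \<Rightarrow> cliff" where
  "X2 i x = (\<lambda>C. 2 * gen_mul i (P1 i x) C + (\<Sum>j\<in>{1..m}. x j * gen_mul j (P2 i i x) C))"

lemma X_time: "X (x(0 := t)) = X x"
  by (auto simp: X_def P_time fun_eq_iff intro!: sum.cong)

lemma has_partial_vector_sum:
  assumes i: "i \<in> {1..m}"
    and A: "\<And>C. ((\<lambda>t. A (x(i := t)) C) has_real_derivative A1 C) (at (x i))"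
  shows "((\<lambda>t. \<Sum>j\<in>{1..m}. (x(i := t)) j * gen_mul j (A (x(i := t))) C) has_real_derivative
           gen_mul i (A x) C + (\<Sum>j\<in>{1..m}. x j * gen_mul j A1 C)) (at (x i))"
proof -
  have "((\<lambda>t. (x(i := t)) j * gen_mul j (A (x(i := t))) C) has_real_derivative
      (if j = i then gen_mul j (A x) C else 0) + x j * gen_mul j A1 C) (at (x i))" for j
  proof -
    have "((\<lambda>t. (x(i := t)) j) has_real_derivative (if j = i then 1 else 0)) (at (x i))"
      by (cases "j = i") auto
    moreover have "((\<lambda>t. gen_mul j (A (x(i := t))) C) has_real_derivative gen_mul j A1 C) (at (x i))"
      unfolding gen_mul_def by (intro DERIV_cmult A)
    ultimately show ?thesis
      by (rule DERIV_cong[OF DERIV_mult]) simp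
  qed
  then have "((\<lambda>t. \<Sum>j\<in>{1..m}. (x(i := t)) j * gen_mul j (A (x(i := t))) C) has_real_derivative
      (\<Sum>j\<in>{1..m}. (if j = i then gen_mul j (A x) C else 0) + x j * gen_mul j A1 C)) (at (x i))"
    by (intro DERIV_sum)
  then show ?thesis
    using i by (simp add: sum.distrib sum.delta)
qed

lemma X_has_partial:
  "i \<in> {1..m} \<Longrightarrow> ((\<lambda>t. X (x(i := t)) C) has_real_derivative X1 i x C) (at (x i))"
  unfolding X_def X1_def by (intro has_partial_vector_sum P_has_partial)

lemma X1_has_partial:
  assumes i: "i \<in> {1..m}"
  shows "((\<lambda>t. X1 i (x(i := t)) C) has_real_derivative X2 i x C) (at (x i))"
proof -
  have 1: "((\<lambda>t. gen_mul i (P (x(i := t))) C) has_real_derivative gen_mul i (P1 i x) C) (at (x i))"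
    unfolding gen_mul_def by (intro DERIV_cmult P_has_partial i)
  have 2: "((\<lambda>t. \<Sum>j\<in>{1..m}. (x(i := t)) j * gen_mul j (P1 i (x(i := t))) C) has_real_derivative
           gen_mul i (P1 i x) C + (\<Sum>j\<in>{1..m}. x j * gen_mul j (P2 i i x) C)) (at (x i))"
    by (intro has_partial_vector_sum P1_has_partial i)
  show ?thesis
    unfolding X1_def X2_def by (rule DERIV_cong[OF DERIV_add[OF 1 2]]) simp
qed

lemma X_Euler: "(\<Sum>i\<in>{1..m}. x i * X1 i x C) = real (k + 1) * X x C"
proof -
  have "(\<Sum>i\<in>{1..m}. x i * (\<Sum>j\<in>{1..m}. x j * gen_mul j (P1 i x) C))
      = (\<Sum>j\<in>{1..m}. x j * gen_mul j (\<lambda>C. \<Sum>i\<in>{1..m}. x i * P1 i x C) C)"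
    unfolding gen_mul_def sum_distrib_left by (subst sum.swap) (simp add: mult_ac)
  also have "\<dots> = real k * X x C"
    by (simp add: Euler gen_mul_scale X_def sum_distrib_left mult_ac)
  finally show ?thesis
    by (simp add: X1_def distrib_left sum.distrib X_def algebra_simps)
qed

text \<open>The Laplacian of x P is twice the Dirac derivative of \<open>P\<close> plus x times the
  Laplacian of \<open>P\<close>; both vanish.\<close>

lemma X_harmonic: "(\<Sum>i\<in>{1..m}. X2 i x C) = 0"
proof -
  have "(\<Sum>i\<in>{1..m}. \<Sum>j\<in>{1..m}. x j * gen_mul j (P2 i i x) C)
      = (\<Sum>j\<in>{1..m}. x j * gen_mul j (\<lambda>C. \<Sum>i\<in>{1..m}. P2 i i x C) C)"
    unfolding gen_mul_def sum_distrib_left by (subst sum.swap) (simp add: mult_ac)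
  also have "\<dots> = 0" by (simp add: P_harmonic)
  finally show ?thesis
    by (simp add: X2_def sum.distrib sum_distrib_left[symmetric] P_monogenic)
qed

lemma sum_gen_mul_X: "(\<Sum>i\<in>{1..m}. x i * gen_mul i (X x) C) = - rsq m x * P x C"
proof -
  have "(\<Sum>i\<in>{1..m}. x i * gen_mul i (X x) C)
      = (\<Sum>i\<in>{1..m}. \<Sum>j\<in>{1..m}. gen_mul i (gen_mul j (\<lambda>C. x i * x j * P x C)) C)"
    by (simp add: X_def gen_mul_def sum_distrib_left mult_ac)
  also have "\<dots> = - (\<Sum>i\<in>{1..m}. x i * x i * P x C)"
    by (subst sum_gen_mul_symmetric) (auto simp: mult_ac)
  also have "\<dots> = - rsq m x * P x C"
    by (simp add: rsq_def sum_distrib_right power2_eq_square)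
  finally show ?thesis .
qed

text \<open>This is the Dirac derivative of x P. Differentiating x gives \<open>m\<close> copies of
  -P. In the rest, moving the generator past x leaves minus twice the Euler operator and minus x
  times the Dirac derivative of \<open>P\<close>, which is zero.\<close>

lemma sum_gen_mul_X1: "(\<Sum>i\<in>{1..m}. gen_mul i (X1 i x) C) = - real (m + 2 * k) * P x C"
proof -
  have swap: "x j * gen_mul i (gen_mul j (P1 i x)) C
      = (if i = j then - 2 * (x i * P1 i x C) else 0) - x j * gen_mul j (gen_mul i (P1 i x)) C" for i j
    by (cases "i = j") (simp_all add: gen_mul_same gen_mul_anticommute[of i j])
  have 0: "(\<Sum>i\<in>{1..m}. \<Sum>j\<in>{1..m}. x j * gen_mul j (gen_mul i (P1 i x)) C) = 0"
  proof -
    have "(\<Sum>i\<in>{1..m}. \<Sum>j\<in>{1..m}. x j * gen_mul j (gen_mul i (P1 i x)) C)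
        = (\<Sum>j\<in>{1..m}. x j * gen_mul j (\<lambda>C. \<Sum>i\<in>{1..m}. gen_mul i (P1 i x) C) C)"
      by (subst sum.swap) (simp add: gen_mul_sum sum_distrib_left)
    then show ?thesis by (simp add: P_monogenic)
  qed
  have "(\<Sum>i\<in>{1..m}. gen_mul i (X1 i x) C)
      = (\<Sum>i\<in>{1..m}. - P x C) + (\<Sum>i\<in>{1..m}. \<Sum>j\<in>{1..m}. x j * gen_mul i (gen_mul j (P1 i x)) C)"
    unfolding X1_def by (simp add: gen_mul_add gen_mul_same gen_mul_sum gen_mul_scale sum.distrib sum_subtractf)
  also have "\<dots> = - real m * P x C + (\<Sum>i\<in>{1..m}. - 2 * (x i * P1 i x C))"
    unfolding swap by (simp add: sum_subtractf 0 sum.delta)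
  also have "\<dots> = - real (m + 2 * k) * P x C"
    unfolding sum_distrib_left[symmetric] Euler by (simp add: algebra_simps)
  finally show ?thesis .
qed

definition radial :: "(real \<Rightarrow> real) \<Rightarrow> (real \<Rightarrow> real) \<Rightarrow> (nat \<Rightarrow> real) \<Rightarrow> cliff" where
  "radial a b p = (\<lambda>C. a (rsq m p) * P p C + b (rsq m p) * X p C)"

lemma radial_apply: "radial a b p C = a (rsq m p) * P p C + b (rsq m p) * X p C"
  by (simp add: radial_def)

lemma cmul_radial:
  "cmul (\<lambda>C. cscal a C + b * cvec m p C) (P p) C = radial (\<lambda>_. a) (\<lambda>_. b) p C"
  by (simp add: cmul_paravector radial_def X_def)

lemma scalar_has_partial:
  assumes i: "i \<in> {1..m}"
    and a: "(a has_real_derivative a') (at (rsq m p))"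
    and f: "((\<lambda>t. f (p(i := t))) has_real_derivative f') (at (p i))"
  shows "((\<lambda>t. a (rsq m (p(i := t))) * f (p(i := t))) has_real_derivative
           2 * p i * a' * f p + a (rsq m p) * f') (at (p i))"
proof -
  have "((\<lambda>t. a (rsq m (p(i := t)))) has_real_derivative a' * (2 * p i)) (at (p i))"
    using DERIV_chain2[OF _ rsq_has_partial[OF i, of p "p i"]] a by simp
  from DERIV_mult[OF this f] show ?thesis
    by (simp add: algebra_simps)
qed

lemma radial_has_partial:
  assumes i: "i \<in> {1..m}"
    and a: "(a has_real_derivative a') (at (rsq m p))"
    and b: "(b has_real_derivative b') (at (rsq m p))"
  shows "((\<lambda>t. radial a b (p(i := t)) C) has_real_derivative
           (2 * p i * a' * P p C + a (rsq m p) * P1 i p C) +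
           (2 * p i * b' * X p C + b (rsq m p) * X1 i p C)) (at (p i))"
  unfolding radial_def
  by (intro DERIV_add scalar_has_partial P_has_partial X_has_partial assms)

text \<open>Product rule, combined with x x P = -s P and the Dirac derivative of x P. Here
  \<open>a'\<close> and \<open>b'\<close> are numbers, the derivatives at \<open>rsq m p\<close>, so
  the identity concerns the point \<open>p\<close> only.\<close>

lemma dirac_radial:
  assumes a: "(a has_real_derivative a') (at (rsq m p))"
    and b: "(b has_real_derivative b') (at (rsq m p))"
  shows "dirac m (radial a b) p
    = radial (\<lambda>s. - 2 * s * b' - real (m + 2 * k) * b s) (\<lambda>_. 2 * a') p"
proof
  fix C
  let ?s = "rsq m p"
  have "dirac m (radial a b) p C = (\<Sum>i\<in>{1..m}. gen_mul i (\<lambda>C.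
      (2 * p i * a' * P p C + a ?s * P1 i p C) + (2 * p i * b' * X p C + b ?s * X1 i p C)) C)"
    unfolding dirac_def cmul_cgen cpartial_def
    by (intro sum.cong refl arg_cong[where f = "\<lambda>f. gen_mul _ f C"] ext DERIV_imp_deriv
        radial_has_partial assms)
  also have "\<dots> = 2 * a' * (\<Sum>i\<in>{1..m}. p i * gen_mul i (P p) C)
      + a ?s * (\<Sum>i\<in>{1..m}. gen_mul i (P1 i p) C)
      + 2 * b' * (\<Sum>i\<in>{1..m}. p i * gen_mul i (X p) C)
      + b ?s * (\<Sum>i\<in>{1..m}. gen_mul i (X1 i p) C)"
    unfolding gen_mul_add gen_mul_scale
    by (simp add: sum.distrib sum_distrib_left algebra_simps)
  also have "(\<Sum>i\<in>{1..m}. p i * gen_mul i (P p) C) = X p C" by (simp add: X_def)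
  finally show "dirac m (radial a b) p C
    = radial (\<lambda>s. - 2 * s * b' - real (m + 2 * k) * b s) (\<lambda>_. 2 * a') p C"
    unfolding P_monogenic sum_gen_mul_X sum_gen_mul_X1
    by (simp add: radial_apply[of _ _ p C] algebra_simps)
qed

lemma radial_second_partials:
  assumes S: "open S" "rsq m p \<in> S"
    and a: "\<And>s. s \<in> S \<Longrightarrow> (a has_real_derivative a1 s) (at s)"
      "\<And>s. s \<in> S \<Longrightarrow> (a1 has_real_derivative a2 s) (at s)"
    and b: "\<And>s. s \<in> S \<Longrightarrow> (b has_real_derivative b1 s) (at s)"
      "\<And>s. s \<in> S \<Longrightarrow> (b1 has_real_derivative b2 s) (at s)"
  shows "(\<Sum>i\<in>{1..m}. cpartial i (cpartial i (radial a b)) p C)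
    = radial (\<lambda>s. 4 * s * a2 s + (2 * real m + 4 * real k) * a1 s)
             (\<lambda>s. 4 * s * b2 s + (2 * real m + 4 * real (k + 1)) * b1 s) p C"
proof -
  let ?s = "rsq m p"
  have second: "cpartial i (cpartial i (radial a b)) p C =
      ((2 * a1 ?s + 4 * (p i)\<^sup>2 * a2 ?s) * P p C + 4 * p i * a1 ?s * P1 i p C + a ?s * P2 i i p C) +
      ((2 * b1 ?s + 4 * (p i)\<^sup>2 * b2 ?s) * X p C + 4 * p i * b1 ?s * X1 i p C + b ?s * X2 i p C)"
    if i: "i \<in> {1..m}" for i
  proof -
    let ?q = "\<lambda>t. p(i := t)"
    \<comment> \<open>The second derivative needs the formula for the first on a whole
      neighbourhood, which the openness of \<open>S\<close> provides.\<close>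
    have ev: "\<forall>\<^sub>F t in nhds (p i). rsq m (?q t) \<in> S"
      by (rule eventually_rsq[OF i S])
    have first: "cpartial i (radial a b) (?q t) C =
        2 * (t * (a1 (rsq m (?q t)) * P (?q t) C)) + a (rsq m (?q t)) * P1 i (?q t) C +
        (2 * (t * (b1 (rsq m (?q t)) * X (?q t) C)) + b (rsq m (?q t)) * X1 i (?q t) C)"
      if "rsq m (?q t) \<in> S" for t
      unfolding cpartial_def
      using radial_has_partial[OF i a(1)[OF that] b(1)[OF that], of C]
      by (intro DERIV_imp_deriv) (simp add: algebra_simps)
    have "((\<lambda>t. 2 * (t * (a1 (rsq m (?q t)) * P (?q t) C)) + a (rsq m (?q t)) * P1 i (?q t) C +
        (2 * (t * (b1 (rsq m (?q t)) * X (?q t) C)) + b (rsq m (?q t)) * X1 i (?q t) C))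
        has_real_derivative
        (2 * (1 * (a1 ?s * P p C) + (2 * p i * a2 ?s * P p C + a1 ?s * P1 i p C) * p i)
          + (2 * p i * a1 ?s * P1 i p C + a ?s * P2 i i p C)) +
        (2 * (1 * (b1 ?s * X p C) + (2 * p i * b2 ?s * X p C + b1 ?s * X1 i p C) * p i)
          + (2 * p i * b1 ?s * X1 i p C + b ?s * X2 i p C))) (at (p i))"
      by (intro DERIV_add DERIV_cmult scalar_has_partial[OF i a(1)[OF S(2)] P1_has_partial[OF i]]
          scalar_has_partial[OF i b(1)[OF S(2)] X1_has_partial[OF i]]
          DERIV_mult[OF DERIV_ident scalar_has_partial[OF i a(2)[OF S(2)] P_has_partial[OF i]],
            unfolded fun_upd_triv]
          DERIV_mult[OF DERIV_ident scalar_has_partial[OF i b(2)[OF S(2)] X_has_partial[OF i]],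
            unfolded fun_upd_triv])
    then have "deriv (\<lambda>t. 2 * (t * (a1 (rsq m (?q t)) * P (?q t) C)) + a (rsq m (?q t)) * P1 i (?q t) C +
        (2 * (t * (b1 (rsq m (?q t)) * X (?q t) C)) + b (rsq m (?q t)) * X1 i (?q t) C)) (p i)
      = (2 * (1 * (a1 ?s * P p C) + (2 * p i * a2 ?s * P p C + a1 ?s * P1 i p C) * p i)
          + (2 * p i * a1 ?s * P1 i p C + a ?s * P2 i i p C)) +
        (2 * (1 * (b1 ?s * X p C) + (2 * p i * b2 ?s * X p C + b1 ?s * X1 i p C) * p i)
          + (2 * p i * b1 ?s * X1 i p C + b ?s * X2 i p C))"
      by (rule DERIV_imp_deriv)
    moreover have "cpartial i (cpartial i (radial a b)) p C =
      deriv (\<lambda>t. 2 * (t * (a1 (rsq m (?q t)) * P (?q t) C)) + a (rsq m (?q t)) * P1 i (?q t) C +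
        (2 * (t * (b1 (rsq m (?q t)) * X (?q t) C)) + b (rsq m (?q t)) * X1 i (?q t) C)) (p i)"
      unfolding cpartial_def[of i "cpartial i (radial a b)"]
      by (intro deriv_cong_ev refl eventually_mono[OF ev] first)
    ultimately show ?thesis
      by (simp add: algebra_simps power2_eq_square)
  qed
  have "(\<Sum>i\<in>{1..m}. cpartial i (cpartial i (radial a b)) p C) =
      (\<Sum>i\<in>{1..m}. (2 * a1 ?s + 4 * (p i)\<^sup>2 * a2 ?s) * P p C + 4 * p i * a1 ?s * P1 i p C + a ?s * P2 i i p C) +
      (\<Sum>i\<in>{1..m}. (2 * b1 ?s + 4 * (p i)\<^sup>2 * b2 ?s) * X p C + 4 * p i * b1 ?s * X1 i p C + b ?s * X2 i p C)"
    unfolding sum.distrib[symmetric] by (intro sum.cong refl second)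
  also have "\<dots> = (4 * ?s * a2 ?s + (2 * real m + 4 * real k) * a1 ?s) * P p C
      + (4 * ?s * b2 ?s + (2 * real m + 4 * real (k + 1)) * b1 ?s) * X p C"
    by (intro arg_cong2[where f = "(+)"] sum_scalar_second_partials Euler P_harmonic X_Euler X_harmonic)
  finally show ?thesis
    by (simp only: radial_apply[of _ _ p C])
qed

end

section \<open>Cauchy--Riemann equations in the variables t = x_0 and s\<close>

text \<open>\<open>uu h n l t s\<close> and \<open>vv h n l t s\<close> are the derivatives \<open>\<partial>\<^sub>s\<^sup>n \<partial>\<^sub>t\<^sup>l\<close> of \<open>Re h(t + i \<surd>s)\<close> and
  \<open>Im h(t + i \<surd>s) / \<surd>s\<close>; the recursion in \<open>n\<close> solves the Cauchy--Riemann equations,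
  differentiated \<open>n\<close> times in \<open>s\<close>, for the highest \<open>s\<close>-derivative.\<close>

fun uu :: "(complex \<Rightarrow> complex) \<Rightarrow> nat \<Rightarrow> nat \<Rightarrow> real \<Rightarrow> real \<Rightarrow> real"
  and vv :: "(complex \<Rightarrow> complex) \<Rightarrow> nat \<Rightarrow> nat \<Rightarrow> real \<Rightarrow> real \<Rightarrow> real" where
  "uu h 0 l t s = Re ((deriv ^^ l) h (Complex t (sqrt s)))"
| "uu h (Suc n) l t s = - vv h n (Suc l) t s / 2"
| "vv h 0 l t s = Im ((deriv ^^ l) h (Complex t (sqrt s))) / sqrt s"
| "vv h (Suc n) l t s = (uu h n (Suc l) t s - (2 * real n + 1) * vv h n l t s) / (2 * s)"

text \<open>The first condition makes \<open>sqrt\<close> differentiable and division by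
  \<open>s\<close> sound. The second puts t + i sqrt s in the disc of radius 1 - sqrt s about i sqrt
  s, which lies in the unit disc, so the Taylor series in \<open>t\<close> converges.\<close>

definition vdom :: "real \<Rightarrow> real \<Rightarrow> bool" where
  "vdom t s \<longleftrightarrow> 0 < s \<and> \<bar>t\<bar> + sqrt s < 1"

lemma vdom_0: "vdom t s \<Longrightarrow> vdom 0 s"
  unfolding vdom_def by linarith

lemma vdom_0_iff: "vdom 0 s \<longleftrightarrow> 0 < s \<and> s < 1"
  by (simp add: vdom_def real_sqrt_lt_1_iff)

lemma open_vdom: "open {s. vdom t s}"
proof -
  have "{s. vdom t s} = {s. 0 < s} \<inter> {s. \<bar>t\<bar> + sqrt s < 1}" by (auto simp: vdom_def)
  then show ?thesis by (simp add: open_Int open_Collect_less continuous_intros)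
qed

lemma open_vdom_time: "open {t. vdom t s}"
proof -
  have "{t. vdom t s} = (if 0 < s then {t. \<bar>t\<bar> + sqrt s < 1} else {})" by (auto simp: vdom_def)
  then show ?thesis by (simp add: open_Collect_less continuous_intros)
qed

lemma vdom_ball: "vdom t s \<Longrightarrow> Complex t (sqrt s) \<in> ball 0 1"
  using complex_Re_le_cmod cmod_le[of "Complex t (sqrt s)"] by (auto simp: vdom_def)

lemma has_real_derivative_Re:
  "(f has_vector_derivative D) F \<Longrightarrow> ((\<lambda>x. Re (f x)) has_real_derivative Re D) F"
  by (simp add: has_real_derivative_iff_has_vector_derivative
      bounded_linear.has_vector_derivative[OF bounded_linear_Re])

lemma has_real_derivative_Im:
  "(f has_vector_derivative D) F \<Longrightarrow> ((\<lambda>x. Im (f x)) has_real_derivative Im D) F"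
  by (simp add: has_real_derivative_iff_has_vector_derivative
      bounded_linear.has_vector_derivative[OF bounded_linear_Im])

lemma higher_deriv_has_field_derivative:
  assumes "h holomorphic_on S" "open S" "z \<in> S"
  shows "((deriv ^^ l) h has_field_derivative (deriv ^^ Suc l) h z) (at z)"
  using holomorphic_derivI[OF holomorphic_higher_deriv[OF assms(1,2)] assms(2,3)] by simp

context
  fixes h :: "complex \<Rightarrow> complex"
  assumes holo: "h holomorphic_on ball 0 1"
begin

lemma deriv_time:
  assumes "vdom t s"
  shows "((\<lambda>t. (deriv ^^ l) h (Complex t (sqrt s))) has_vector_derivative
           (deriv ^^ Suc l) h (Complex t (sqrt s))) (at t)"
proof -
  have "((\<lambda>t. Complex t (sqrt s)) has_vector_derivative 1) (at t)"
    unfolding Complex_eq by (auto intro!: derivative_eq_intros)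
  from field_vector_diff_chain_at[OF this higher_deriv_has_field_derivative[OF holo]]
  show ?thesis using vdom_ball[OF assms] by (simp add: o_def)
qed

lemma deriv_sq:
  assumes "vdom t s"
  shows "((\<lambda>s. (deriv ^^ l) h (Complex t (sqrt s))) has_vector_derivative
           \<i> * complex_of_real (1 / (2 * sqrt s)) * (deriv ^^ Suc l) h (Complex t (sqrt s))) (at s)"
proof -
  have "(sqrt has_real_derivative 1 / (2 * sqrt s)) (at s)"
    using assms by (auto intro!: derivative_eq_intros simp: vdom_def divide_simps)
  then have "((\<lambda>s. complex_of_real (sqrt s)) has_vector_derivative complex_of_real (1 / (2 * sqrt s))) (at s)"
    by (rule has_vector_derivative_of_real)
  then have "((\<lambda>s. Complex t (sqrt s)) has_vector_derivative \<i> * complex_of_real (1 / (2 * sqrt s))) (at s)"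
    unfolding Complex_eq
    by (intro has_vector_derivative_eq_rhs[OF has_vector_derivative_add
          [OF has_vector_derivative_const has_vector_derivative_mult_right]]) auto
  from field_vector_diff_chain_at[OF this higher_deriv_has_field_derivative[OF holo]]
  show ?thesis using vdom_ball[OF assms] by (simp add: o_def)
qed

lemma uu_vv_time:
  assumes "vdom t s"
  shows "((\<lambda>t. uu h n l t s) has_real_derivative uu h n (Suc l) t s) (at t)"
    and "((\<lambda>t. vv h n l t s) has_real_derivative vv h n (Suc l) t s) (at t)"
proof (induction n arbitrary: l)
  case 0
  {
    case 1
    show ?case using has_real_derivative_Re[OF deriv_time[OF assms]] by simp
  next
    case 2
    show ?case using DERIV_cdivide[OF has_real_derivative_Im[OF deriv_time[OF assms]]] by simp
  }
next
  case (Suc n)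
  {
    case 1
    show ?case unfolding uu.simps by (intro DERIV_cdivide DERIV_minus Suc)
  next
    case 2
    show ?case unfolding vv.simps by (intro DERIV_cdivide DERIV_diff DERIV_cmult Suc)
  }
qed

text \<open>For \<open>n = 0\<close> this is the chain rule at t + i sqrt s; afterwards the
  recursion itself is differentiated.\<close>

lemma uu_vv_sq:
  assumes "vdom t s"
  shows "((\<lambda>s. uu h n l t s) has_real_derivative uu h (Suc n) l t s) (at s)"
    and "((\<lambda>s. vv h n l t s) has_real_derivative vv h (Suc n) l t s) (at s)"
proof (induction n arbitrary: l)
  case 0
  have s: "s > 0" using assms by (simp add: vdom_def)
  {
    case 1
    show ?case using has_real_derivative_Re[OF deriv_sq[OF assms]] by (simp add: field_simps)
  next
    case 2
    have "(sqrt has_real_derivative 1 / (2 * sqrt s)) (at s)"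
      using s by (auto intro!: derivative_eq_intros simp: divide_simps)
    from DERIV_divide[OF has_real_derivative_Im[OF deriv_sq[OF assms]] this, of l] s
    show ?case by (simp add: divide_simps) (simp add: algebra_simps)
  }
next
  case (Suc n)
  have s: "s > 0" using assms by (simp add: vdom_def)
  {
    case 1
    show ?case unfolding uu.simps(2)[of h n] uu.simps(2)[of h "Suc n"]
      by (intro DERIV_cdivide DERIV_minus Suc)
  next
    case 2
    have "((\<lambda>s. 2 * s) has_real_derivative 2) (at s)"
      by (auto intro!: derivative_eq_intros)
    from DERIV_divide[OF DERIV_diff[OF Suc(1)[of "Suc l"] DERIV_cmult[OF Suc(2)[of l], of "2 * real n + 1"]] this] s
    have "((\<lambda>s. vv h (Suc n) l t s) has_real_derivative
       ((uu h (Suc n) (Suc l) t s - (2 * real n + 1) * vv h (Suc n) l t s) * (2 * s)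
         - (2 * s * vv h (Suc n) l t s) * 2) / (2 * s * (2 * s))) (at s)"
      by simp
    \<comment> \<open>Differentiating the denominator \<open>2 * s\<close> contributes a further
      \<open>- 2 * V\<close>, which raises 2n + 1 to 2n + 3.\<close>
    moreover have "((A - (2 * real n + 1) * V) * (2 * s) - (2 * s * V) * 2) / (2 * s * (2 * s))
        = (A - (2 * real (Suc n) + 1) * V) / (2 * s)" for A V
      using s by (simp add: divide_simps) (simp add: algebra_simps)
    ultimately show ?case
      unfolding vv.simps(2)[of h "Suc n"] by (simp only:)
  }
qed

text \<open>For \<open>n = 0\<close> this is the power series about i sqrt s along a real
  displacement \<open>t\<close>. The recursion is linear with coefficients free of \<open>t\<close>,
  so it carries the sums to larger \<open>n\<close>.\<close>

lemma uu_vv_Taylor: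
  assumes "vdom t s"
  shows "(\<lambda>j. uu h n (l + j) 0 s * t ^ j / fact j) sums uu h n l t s"
    and "(\<lambda>j. vv h n (l + j) 0 s * t ^ j / fact j) sums vv h n l t s"
proof (induction n arbitrary: l)
  case 0
  let ?z = "Complex 0 (sqrt s)"
  have s: "s > 0" and ts: "\<bar>t\<bar> < 1 - sqrt s" using assms by (auto simp: vdom_def)
  have nz: "cmod ?z = sqrt s" using s by (simp add: cmod_def)
  have sub: "ball ?z (1 - sqrt s) \<subseteq> ball 0 1"
    by (simp add: ball_subset_ball_iff dist_norm nz)
  have **: "(\<lambda>j. complex_of_real (t ^ j / fact j) * (deriv ^^ (l + j)) h ?z)
      sums (deriv ^^ l) h (Complex t (sqrt s))" for l
  proof -
    have diff: "Complex t (sqrt s) - ?z = of_real t" by (simp add: complex_eq_iff)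
    then have "Complex t (sqrt s) \<in> ball ?z (1 - sqrt s)"
      using ts by (simp add: dist_norm norm_minus_commute[of ?z "Complex t (sqrt s)"])
    moreover have "(deriv ^^ l) h holomorphic_on ball ?z (1 - sqrt s)"
      using holomorphic_on_subset[OF holomorphic_higher_deriv[OF holo] sub] by blast
    ultimately have "(\<lambda>j. (deriv ^^ j) ((deriv ^^ l) h) ?z / fact j * (Complex t (sqrt s) - ?z) ^ j)
        sums (deriv ^^ l) h (Complex t (sqrt s))"
      by (intro holomorphic_power_series)
    moreover have "(deriv ^^ j) ((deriv ^^ l) h) ?z / fact j * of_real t ^ j
        = complex_of_real (t ^ j / fact j) * (deriv ^^ (l + j)) h ?z" for j
      by (simp add: funpow_add add.commute[of l])
    ultimately show ?thesis by (simp only: diff)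
  qed
  have Re: "Re (complex_of_real (t ^ j / fact j) * z) = Re z * t ^ j / fact j" for j z
    by (simp only: times_complex.sel Re_complex_of_real Im_complex_of_real) simp
  have Im: "Im (complex_of_real (t ^ j / fact j) * z) / sqrt s = Im z / sqrt s * t ^ j / fact j" for j z
    by (simp only: times_complex.sel Re_complex_of_real Im_complex_of_real) (simp add: mult_ac)
  {
    case 1
    show ?case using sums_Re[OF **] unfolding Re by simp
  next
    case 2
    show ?case using sums_divide[OF sums_Im[OF **], where c = "sqrt s"] unfolding Im by simp
  }
next
  case (Suc n)
  {
    case 1
    show ?case
      using sums_divide[OF sums_minus[OF Suc(2)[of "Suc l"]], of 2] by (simp add: mult.commute[of 2])
  next
    case 2
    show ?case
      using sums_divide[OF sums_diff[OF Suc(1)[of "Suc l"] sums_mult[OF Suc(2)[of l], of "2 * real n + 1"]], of "2 * s"]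
      by (simp add: diff_divide_distrib left_diff_distrib right_diff_distrib mult_ac)
  }
qed

end

text \<open>The recursion solved for the \<open>t\<close>-derivatives: the \<open>n\<close>-fold
  \<open>s\<close>-derivative of u_t = 2 s v_s + v and v_t = -2 u_s.\<close>

lemma uu_vv_Suc:
  assumes "vdom t s"
  shows "uu h n (Suc l) t s = 2 * s * vv h (Suc n) l t s + (2 * real n + 1) * vv h n l t s"
    and "vv h n (Suc l) t s = - 2 * uu h (Suc n) l t s"
  using assms by (auto simp: vdom_def)

lemma uu_vv_wave:
  assumes "vdom t s"
  shows "uu h n (Suc (Suc l)) t s = - 4 * s * uu h (Suc (Suc n)) l t s - (4 * real n + 2) * uu h (Suc n) l t s"
    and "vv h n (Suc (Suc l)) t s = - 4 * s * vv h (Suc (Suc n)) l t s - (4 * real n + 6) * vv h (Suc n) l t s"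
  unfolding uu_vv_Suc[OF assms] by (simp_all add: algebra_simps del: uu.simps vv.simps)

text \<open>By \<open>uu_vv_Suc\<close>, each further \<open>t\<close>-derivative at
  \<open>t = 0\<close> is determined by the previous ones and their \<open>s\<close>-derivatives, so
  proportionality for all \<open>s\<close> propagates.\<close>

lemma uu_vv_initial_cong:
  assumes h: "h holomorphic_on ball 0 1" and g: "g holomorphic_on ball 0 1"
    and u0: "\<And>s. vdom 0 s \<Longrightarrow> uu h n 0 0 s = c * uu g n 0 0 s"
    and v0: "\<And>s. vdom 0 s \<Longrightarrow> vv h n 0 0 s = c * vv g n 0 0 s"
  shows "vdom 0 s \<Longrightarrow> uu h n l 0 s = c * uu g n l 0 s"
    and "vdom 0 s \<Longrightarrow> vv h n l 0 s = c * vv g n l 0 s"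
proof (induction l arbitrary: s)
  case 0
  { case 1 then show ?case by (rule u0) next case 2 then show ?case by (rule v0) }
next
  case (Suc l)
  have step: "f' = c * g'"
    if "\<And>s. vdom 0 s \<Longrightarrow> f s = c * g s" "(f has_real_derivative f') (at s)"
       "(g has_real_derivative g') (at s)" "vdom 0 s" for f g f' g' s
  proof -
    have "((\<lambda>s. c * g s) has_real_derivative f') (at s)"
      by (rule has_field_derivative_transform_within_open[OF that(2) open_vdom[of 0]])
        (use that in auto)
    then show ?thesis using DERIV_cmult[OF that(3)] DERIV_unique by blast
  qed
  {
    case 1
    then show ?case
      using step[OF Suc(2) uu_vv_sq(2)[OF h] uu_vv_sq(2)[OF g]] Suc(2)
      by (simp only: uu_vv_Suc) (simp add: algebra_simps del: uu.simps vv.simps)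
  next
    case 2
    then show ?case
      using step[OF Suc(1) uu_vv_sq(1)[OF h] uu_vv_sq(1)[OF g]]
      by (simp only: uu_vv_Suc)
  }
qed

section \<open>Initial values of functions of z^2\<close>

lemma square_holomorphic:
  assumes "q holomorphic_on ball 0 1"
  shows "(\<lambda>z. q (z\<^sup>2)) holomorphic_on ball 0 (1::real)"
proof -
  have "q \<circ> (\<lambda>z. z\<^sup>2) holomorphic_on ball 0 1"
    by (rule holomorphic_on_compose_gen[OF _ assms])
      (auto intro!: holomorphic_intros simp: norm_power abs_square_less_1)
  then show ?thesis by (simp add: o_def)
qed

text \<open>At \<open>t = 0\<close> the point i sqrt s has square -s. Reality of \<open>q\<close>
  there makes the imaginary part vanish, and each \<open>s\<close>-derivative brings a factor
  -1.\<close>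

lemma uu_vv_square_initial:
  assumes q: "q holomorphic_on ball 0 1"
    and real: "\<And>s. 0 < s \<Longrightarrow> s < 1 \<Longrightarrow> q (- complex_of_real s) \<in> \<real>"
    and s: "0 < s" "s < 1"
  shows "uu (\<lambda>z. q (z\<^sup>2)) n 0 0 s = (-1) ^ n * Re ((deriv ^^ n) q (- complex_of_real s))"
    and "vv (\<lambda>z. q (z\<^sup>2)) n 0 0 s = 0"
proof -
  let ?h = "\<lambda>z. q (z\<^sup>2)"
  note h = square_holomorphic[OF q]
  note unique = DERIV_unique[OF has_field_derivative_transform_within_open[OF _ open_vdom[of 0]]]
  have sq: "(Complex 0 (sqrt s))\<^sup>2 = - complex_of_real s" if "0 < s" for s
    using that by (simp add: complex_eq_iff power2_eq_square)
  have "(\<forall>s. vdom 0 s \<longrightarrow> uu ?h n 0 0 s = (-1) ^ n * Re ((deriv ^^ n) q (- complex_of_real s))) \<and>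
        (\<forall>s. vdom 0 s \<longrightarrow> vv ?h n 0 0 s = 0)"
  proof (induction n)
    case 0
    show ?case using real by (auto simp: sq vdom_0_iff complex_is_Real_iff)
  next
    case (Suc n)
    show ?case
    proof (intro conjI allI impI)
      fix s assume s: "vdom 0 s"
      have "((deriv ^^ n) q has_field_derivative (deriv ^^ Suc n) q (- complex_of_real s)) (at (- complex_of_real s))"
        by (rule higher_deriv_has_field_derivative[OF q]) (use s in \<open>auto simp: vdom_0_iff\<close>)
      moreover have "((\<lambda>s. - complex_of_real s) has_vector_derivative -1) (at s)"
        by (auto intro!: derivative_eq_intros)
      ultimately have "((\<lambda>s. (deriv ^^ n) q (- complex_of_real s)) has_vector_derivative
          - (deriv ^^ Suc n) q (- complex_of_real s)) (at s)"
        using field_vector_diff_chain_at by (fastforce simp: o_def)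
      from DERIV_cmult[OF has_real_derivative_Re[OF this], of "(-1) ^ n"]
      show "uu ?h (Suc n) 0 0 s = (-1) ^ Suc n * Re ((deriv ^^ Suc n) q (- complex_of_real s))"
        using unique[OF uu_vv_sq(1)[OF h s] _ _ \<open>((\<lambda>s. (-1) ^ n * Re _) has_real_derivative _) _\<close>] Suc s
        by simp
      show "vv ?h (Suc n) 0 0 s = 0"
        using unique[OF uu_vv_sq(2)[OF h s] _ _ DERIV_const[of 0]] Suc s by simp
    qed
  qed
  then show "uu ?h n 0 0 s = (-1) ^ n * Re ((deriv ^^ n) q (- complex_of_real s))" "vv ?h n 0 0 s = 0"
    using s by (auto simp: vdom_0_iff)
qed

section \<open>Primitives that are real on the real axis\<close>

lemma real_primitive:
  fixes f :: "complex \<Rightarrow> complex"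
  assumes f: "f holomorphic_on ball 0 1" and real: "\<And>x. \<bar>x\<bar> < 1 \<Longrightarrow> f (complex_of_real x) \<in> \<real>"
  obtains F where "F holomorphic_on ball 0 1" "\<And>x. \<bar>x\<bar> < 1 \<Longrightarrow> F (complex_of_real x) \<in> \<real>"
    "\<And>z. z \<in> ball 0 1 \<Longrightarrow> deriv F z = f z"
proof -
  obtain G where G: "\<And>z. z \<in> ball 0 1 \<Longrightarrow> (G has_field_derivative f z) (at z within ball 0 1)"
    using holomorphic_convex_primitive'[OF _ _ f] by auto
  \<comment> \<open>This normalisation gives \<open>F 0 = 0\<close>. As \<open>f\<close> is real on
    the axis, the imaginary part of \<open>F\<close> is constant there, hence zero.\<close>
  define F where "F z = G z - G 0" for z
  have F: "(F has_field_derivative f z) (at z)" if "z \<in> ball 0 1" for z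
    using DERIV_diff[OF G[OF that] DERIV_const] unfolding F_def
    by (simp add: at_within_open[OF that open_ball])
  have "Im (F (complex_of_real x)) = 0" if x: "\<bar>x\<bar> < 1" for x
  proof -
    have "((\<lambda>x. Im (F (complex_of_real x))) has_real_derivative 0) (at y)" if "y \<in> {-1<..<1}" for y
    proof -
      have y: "\<bar>y\<bar> < 1" using that by auto
      have "((\<lambda>x. F (complex_of_real x)) has_vector_derivative f (complex_of_real y)) (at y)"
        using field_vector_diff_chain_at[OF has_vector_derivative_of_real[OF DERIV_ident] F, of y] y
        by (simp add: o_def)
      from has_real_derivative_Im[OF this] show ?thesis
        using real[OF y] by (simp add: complex_is_Real_iff)
    qed
    then obtain c where "\<And>y. y \<in> {-1<..<1} \<Longrightarrow> Im (F (complex_of_real y)) = c"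
      using has_field_derivative_zero_constant[of "{-1<..<1::real}" "\<lambda>x. Im (F (complex_of_real x))"]
      by (metis convex_real_interval(8) has_field_derivative_at_within)
    from this[of x] this[of 0] x show ?thesis by (simp add: F_def abs_less_iff)
  qed
  moreover have "F holomorphic_on ball 0 1"
    unfolding holomorphic_on_open[OF open_ball] using F by blast
  ultimately show ?thesis
    using F by (intro that[of F]) (auto simp: complex_is_Real_iff intro: DERIV_imp_deriv)
qed

lemma higher_deriv_cong_open:
  assumes "open S" "\<And>z. z \<in> S \<Longrightarrow> f z = g z" "z \<in> S"
  shows "(deriv ^^ n) f z = (deriv ^^ n) g z"
  using assms by (intro higher_deriv_cong_ev) (auto simp: eventually_nhds)

lemma real_iterated_primitive:
  fixes f :: "complex \<Rightarrow> complex"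
  assumes f: "f holomorphic_on ball 0 1" and real: "\<And>x. \<bar>x\<bar> < 1 \<Longrightarrow> f (complex_of_real x) \<in> \<real>"
  obtains F where "F holomorphic_on ball 0 1" "\<And>x. \<bar>x\<bar> < 1 \<Longrightarrow> F (complex_of_real x) \<in> \<real>"
    "\<And>z. z \<in> ball 0 1 \<Longrightarrow> (deriv ^^ n) F z = f z"
proof (induction n arbitrary: thesis)
  case 0
  show ?case by (rule 0[OF f real]) auto
next
  case (Suc n)
  obtain F where F: "F holomorphic_on ball 0 1" "\<And>x. \<bar>x\<bar> < 1 \<Longrightarrow> F (complex_of_real x) \<in> \<real>"
    "\<And>z. z \<in> ball 0 1 \<Longrightarrow> (deriv ^^ n) F z = f z"
    using Suc.IH by blast
  obtain G where G: "G holomorphic_on ball 0 1" "\<And>x. \<bar>x\<bar> < 1 \<Longrightarrow> G (complex_of_real x) \<in> \<real>"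
    "\<And>z. z \<in> ball 0 1 \<Longrightarrow> deriv G z = F z"
    using real_primitive[OF F(1,2)] by blast
  have "(deriv ^^ Suc n) G z = f z" if "z \<in> ball 0 1" for z
    using higher_deriv_cong_open[OF open_ball G(3) that] F(3)[OF that]
    by (simp add: funpow_swap1 del: funpow.simps) (simp add: funpow_Suc_right del: funpow.simps)
  then show ?case using Suc.prems G by blast
qed

section \<open>Powers of 1 + z on the unit disc\<close>

lemma Re_one_plus: "(z::complex) \<in> ball 0 1 \<Longrightarrow> Re (1 + z) > 0"
  using abs_Re_le_cmod[of z] by auto

lemma one_plus_not_nonpos: "(z::complex) \<in> ball 0 1 \<Longrightarrow> 1 + z \<notin> \<real>\<^sub>\<le>\<^sub>0"
  using Re_one_plus[of z] by (auto simp: complex_nonpos_Reals_iff)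

lemma powr_holomorphic: "(\<lambda>z. (1 + z) powr c) holomorphic_on ball 0 (1::real)"
  by (intro holomorphic_intros one_plus_not_nonpos)

lemma powr_real:
  assumes "\<bar>x\<bar> < 1"
  shows "(1 + complex_of_real x) powr complex_of_real c = complex_of_real ((1 + x) powr c)"
  using assms powr_of_real[of "1 + x" c] by simp

lemma higher_deriv_powr:
  fixes z c :: complex
  assumes "z \<in> ball 0 1"
  shows "(deriv ^^ n) (\<lambda>z. (1 + z) powr c) z = (\<Prod>j<n. c - of_nat j) * (1 + z) powr (c - of_nat n)"
  using assms
proof (induction n arbitrary: z)
  case (Suc n)
  have "(deriv ^^ Suc n) (\<lambda>z. (1 + z) powr c) z
      = deriv (\<lambda>z. (\<Prod>j<n. c - of_nat j) * (1 + z) powr (c - of_nat n)) z"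
    unfolding funpow.simps o_def
    using Suc by (intro deriv_cong_ev) (auto simp: eventually_nhds intro!: exI[of _ "ball 0 1"])
  also have "\<dots> = (\<Prod>j<n. c - of_nat j) * ((c - of_nat n) * (1 + z) powr (c - of_nat n - 1))"
    using DERIV_chain2[OF has_field_derivative_powr[OF one_plus_not_nonpos[OF Suc.prems]]
        DERIV_add[OF DERIV_const DERIV_ident]]
    by (intro DERIV_imp_deriv DERIV_cmult) simp
  finally show ?case by (simp add: algebra_simps)
qed simp

section \<open>Laplacian, Fueter map and CK extension of wave fields\<close>

context monogenic_poly
begin

text \<open>\<open>n\<close> counts \<open>s\<close>-derivatives and \<open>l\<close> time
  derivatives; \<open>c\<close> gathers the scalars produced by successive Laplacians.\<close>

definition wave_field :: "real \<Rightarrow> (complex \<Rightarrow> complex) \<Rightarrow> nat \<Rightarrow> nat \<Rightarrow> (nat \<Rightarrow> real) \<Rightarrow> cliff" where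
  "wave_field c h n l p = radial (\<lambda>s. c * uu h n l (p 0) s) (\<lambda>s. c * vv h n l (p 0) s) p"

definition wave_dom :: "(nat \<Rightarrow> real) \<Rightarrow> bool" where
  "wave_dom p \<longleftrightarrow> vdom (p 0) (rsq m p)"

lemma eventually_dom:
  assumes "wave_dom p" "j \<le> m"
  shows "\<forall>\<^sub>F t in nhds (p j). wave_dom (p(j := t))"
proof (cases "j = 0")
  case True
  then show ?thesis
    using assms eventually_nhds_in_open[OF open_vdom_time, of "p 0" "rsq m p"] by (simp add: wave_dom_def)
next
  case False
  then show ?thesis
    using assms eventually_rsq[OF _ open_vdom[of "p 0"], of j m p] by (simp add: wave_dom_def)
qed

lemma cpartial_cong:
  assumes "\<forall>\<^sub>F t in nhds (p j). f (p(j := t)) = g (p(j := t))"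
  shows "cpartial j f p = cpartial j g p"
  unfolding cpartial_def using assms
  by (intro ext deriv_cong_ev) (auto elim: eventually_mono)

text \<open>Partial derivatives see only nearby points on coordinate lines, along which
  \<open>wave_dom\<close> is open; this is used once for each order of differentiation.\<close>

lemma lap_cong:
  assumes fg: "\<And>q. wave_dom q \<Longrightarrow> f q = g q" and p: "wave_dom p"
  shows "lap m f p = lap m g p"
proof -
  have first: "cpartial j f q = cpartial j g q" if "wave_dom q" "j \<le> m" for q j
    by (intro cpartial_cong eventually_mono[OF eventually_dom[OF that]] fg)
  have "cpartial j (cpartial j f) p = cpartial j (cpartial j g) p" if "j \<le> m" for j
    by (intro cpartial_cong eventually_mono[OF eventually_dom[OF p that]] first that)
  then show ?thesis
    unfolding lap_def by (intro ext sum.cong refl) simp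
qed

lemma cpartial_time:
  assumes h: "h holomorphic_on ball 0 1" and p: "wave_dom p"
  shows "cpartial 0 (wave_field c h n l) p = wave_field c h n (Suc l) p"
proof
  fix C
  have "wave_field c h n l (p(0 := t)) C
      = c * uu h n l t (rsq m p) * P p C + c * vv h n l t (rsq m p) * X p C" for t
    by (simp add: wave_field_def radial_apply P_time X_time)
  moreover have "((\<lambda>t. c * uu h n l t (rsq m p) * P p C + c * vv h n l t (rsq m p) * X p C)
      has_real_derivative
      c * uu h n (Suc l) (p 0) (rsq m p) * P p C + c * vv h n (Suc l) (p 0) (rsq m p) * X p C) (at (p 0))"
    using p unfolding wave_dom_def
    by (intro DERIV_add DERIV_cmult_right DERIV_cmult uu_vv_time h)
  ultimately show "cpartial 0 (wave_field c h n l) p C = wave_field c h n (Suc l) p C"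
    by (simp add: cpartial_def wave_field_def radial_apply DERIV_imp_deriv)
qed

lemma cpartial_time_time:
  assumes h: "h holomorphic_on ball 0 1" and p: "wave_dom p"
  shows "cpartial 0 (cpartial 0 (wave_field c h n l)) p = wave_field c h n (Suc (Suc l)) p"
proof -
  have "cpartial 0 (cpartial 0 (wave_field c h n l)) p = cpartial 0 (wave_field c h n (Suc l)) p"
    by (intro cpartial_cong eventually_mono[OF eventually_dom[OF p]] cpartial_time[OF h]) simp_all
  then show ?thesis by (simp add: cpartial_time[OF h p])
qed

lemma cpartial_space_space:
  assumes h: "h holomorphic_on ball 0 1" and p: "wave_dom p"
  shows "(\<Sum>i\<in>{1..m}. cpartial i (cpartial i (wave_field c h n l)) p C)
    = radial (\<lambda>s. 4 * s * (c * uu h (Suc (Suc n)) l (p 0) s)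
                + (2 * real m + 4 * real k) * (c * uu h (Suc n) l (p 0) s))
             (\<lambda>s. 4 * s * (c * vv h (Suc (Suc n)) l (p 0) s)
                + (2 * real m + 4 * real (k + 1)) * (c * vv h (Suc n) l (p 0) s)) p C"
proof -
  let ?r = "radial (\<lambda>s. c * uu h n l (p 0) s) (\<lambda>s. c * vv h n l (p 0) s)"
  \<comment> \<open>Spatial differentiation leaves \<open>p 0\<close> fixed, so time may be frozen
    in the coefficients.\<close>
  have "cpartial i (cpartial i (wave_field c h n l)) p C = cpartial i (cpartial i ?r) p C"
    if "i \<in> {1..m}" for i
    using that by (simp add: cpartial_def wave_field_def)
  then have "(\<Sum>i\<in>{1..m}. cpartial i (cpartial i (wave_field c h n l)) p C)
      = (\<Sum>i\<in>{1..m}. cpartial i (cpartial i ?r) p C)"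
    by (intro sum.cong) auto
  also have "\<dots> = radial (\<lambda>s. 4 * s * (c * uu h (Suc (Suc n)) l (p 0) s)
                + (2 * real m + 4 * real k) * (c * uu h (Suc n) l (p 0) s))
             (\<lambda>s. 4 * s * (c * vv h (Suc (Suc n)) l (p 0) s)
                + (2 * real m + 4 * real (k + 1)) * (c * vv h (Suc n) l (p 0) s)) p C"
    using p unfolding wave_dom_def
    by (intro radial_second_partials[OF open_vdom[of "p 0"]] DERIV_cmult uu_vv_sq h) auto
  finally show ?thesis .
qed

text \<open>By \<open>uu_vv_wave\<close> the time part cancels the spatial terms with factor 4s. The
  remaining factors are 4N + 2 against 4n + 2 for \<open>uu\<close> and 4N + 6 against 4n + 6 for
  \<open>vv\<close>, with the same difference.\<close>

lemma lap_wave_field: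
  assumes h: "h holomorphic_on ball 0 1" and p: "wave_dom p" and N: "m + 2 * k = 2 * N + 1"
  shows "lap m (wave_field c h n 0) p = wave_field (4 * (real N - real n) * c) h (Suc n) 0 p"
proof
  fix C
  let ?s = "rsq m p" and ?t = "p 0"
  have N': "2 * real m + 4 * real k = 4 * real N + 2"
    using arg_cong[OF N, of real] by simp
  have "{0..m} = insert 0 {1..m}" by auto
  then have "lap m (wave_field c h n 0) p C = wave_field c h n (Suc (Suc 0)) p C
      + (\<Sum>i\<in>{1..m}. cpartial i (cpartial i (wave_field c h n 0)) p C)"
    by (simp add: lap_def cpartial_time_time[OF h p])
  also have "\<dots> = (c * uu h n (Suc (Suc 0)) ?t ?s + 4 * ?s * (c * uu h (Suc (Suc n)) 0 ?t ?s)
        + (4 * real N + 2) * (c * uu h (Suc n) 0 ?t ?s)) * P p C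
      + (c * vv h n (Suc (Suc 0)) ?t ?s + 4 * ?s * (c * vv h (Suc (Suc n)) 0 ?t ?s)
        + (4 * real N + 6) * (c * vv h (Suc n) 0 ?t ?s)) * X p C"
  proof -
    have "2 * real m + 4 * real (k + 1) = 4 * real N + 6" using N' by simp
    then show ?thesis
      unfolding cpartial_space_space[OF h p] wave_field_def radial_apply[of _ _ p C] N'
      by (simp only: distrib_right add_ac)
  qed
  also have "\<dots> = wave_field (4 * (real N - real n) * c) h (Suc n) 0 p C"
    using p unfolding wave_dom_def
    by (simp only: uu_vv_wave wave_field_def radial_apply[of _ _ p C])
      (simp add: algebra_simps del: uu.simps vv.simps)
  finally show "lap m (wave_field c h n 0) p C = wave_field (4 * (real N - real n) * c) h (Suc n) 0 p C" .
qed

lemma lap_iterate_wave_field: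
  assumes h: "h holomorphic_on ball 0 1" and N: "m + 2 * k = 2 * N + 1"
    and f: "\<And>q. wave_dom q \<Longrightarrow> f q = wave_field 1 h 0 0 q"
  shows "wave_dom p \<Longrightarrow> (lap m ^^ n) f p = wave_field (\<Prod>i<n. 4 * (real N - real i)) h n 0 p"
proof (induction n arbitrary: p)
  case (Suc n)
  have "(lap m ^^ Suc n) f p = lap m (wave_field (\<Prod>i<n. 4 * (real N - real i)) h n 0) p"
    using lap_cong[OF Suc.IH Suc.prems] by simp
  then show ?case
    by (simp add: lap_wave_field[OF h Suc.prems N] mult_ac del: uu.simps vv.simps)
qed (simp add: f)

lemma Ft_eq:
  assumes h: "h holomorphic_on ball 0 1" and N: "m + 2 * k = 2 * N + 1" and p: "wave_dom p"
  shows "Ft m k h P p = wave_field (\<Prod>i<N. 4 * (real N - real i)) h N 0 p"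
proof -
  let ?F = "\<lambda>p. let z = Complex (p 0) (rad m p) in
        cmul (\<lambda>C. cscal (Re (h z)) C + cvec m p C / rad m p * Im (h z)) (P p)"
  \<comment> \<open>This holds even at radius 0, where both sides divide by zero with value
    0.\<close>
  have "?F q = wave_field 1 h 0 0 q" for q
  proof
    fix C
    have "?F q C = cmul (\<lambda>C. cscal (Re (h (Complex (q 0) (rad m q)))) C
        + Im (h (Complex (q 0) (rad m q))) / rad m q * cvec m q C) (P q) C"
      by (simp add: Let_def mult.commute)
    also have "\<dots> = wave_field 1 h 0 0 q C"
      unfolding cmul_radial wave_field_def by (simp add: radial_apply rad_eq_sqrt)
    finally show "?F q C = wave_field 1 h 0 0 q C" .
  qed
  moreover have "k + (m - 1) div 2 = N" using N by presburger
  ultimately show ?thesis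
    unfolding Ft_def using lap_iterate_wave_field[OF h N _ p] by simp
qed

text \<open>The factor m + 2k = 2N + 1 in \<open>dirac_radial\<close> matches 2n + 1 in
  \<open>uu_vv_Suc\<close> exactly at n = N. Hence, at time 0, the Dirac operator acts as minus the
  time derivative.\<close>

lemma dirac_wave:
  assumes h: "h holomorphic_on ball 0 1" and N: "m + 2 * k = 2 * N + 1" and p: "vdom 0 (rsq m p)"
  shows "dirac m (radial (\<lambda>s. c * uu h N l 0 s) (\<lambda>s. c * vv h N l 0 s)) p
    = radial (\<lambda>s. - c * uu h N (Suc l) 0 s) (\<lambda>s. - c * vv h N (Suc l) 0 s) p"
proof -
  have N': "real (m + 2 * k) = 2 * real N + 1"
    using arg_cong[OF N, of real] by simp
  have "dirac m (radial (\<lambda>s. c * uu h N l 0 s) (\<lambda>s. c * vv h N l 0 s)) p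
    = radial (\<lambda>s. - 2 * s * (c * vv h (Suc N) l 0 (rsq m p)) - real (m + 2 * k) * (c * vv h N l 0 s))
        (\<lambda>_. 2 * (c * uu h (Suc N) l 0 (rsq m p))) p"
    by (intro dirac_radial DERIV_cmult uu_vv_sq h p)
  then show ?thesis
    unfolding N' radial_def uu_vv_Suc[OF p]
    by (simp add: algebra_simps del: uu.simps vv.simps)
qed

lemma dirac_cong:
  assumes fg: "\<And>q. vdom 0 (rsq m q) \<Longrightarrow> f q = g q" and p: "vdom 0 (rsq m p)"
  shows "dirac m f p = dirac m g p"
proof -
  have "cpartial i f p = cpartial i g p" if "i \<in> {1..m}" for i
  proof -
    have "\<forall>\<^sub>F t in nhds (p i). vdom 0 (rsq m (p(i := t)))"
      using eventually_rsq[OF that open_vdom[of 0]] p by simp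
    then show ?thesis
      by (intro cpartial_cong) (auto elim!: eventually_mono intro: fg)
  qed
  then show ?thesis
    unfolding dirac_def by (intro ext sum.cong refl) simp
qed

lemma dirac_iterate_wave:
  assumes h: "h holomorphic_on ball 0 1" and N: "m + 2 * k = 2 * N + 1"
    and g: "\<And>q. vdom 0 (rsq m q) \<Longrightarrow> g q = radial (uu h N 0 0) (vv h N 0 0) q"
  shows "vdom 0 (rsq m p) \<Longrightarrow>
    (dirac m ^^ n) g p = radial (\<lambda>s. (-1) ^ n * uu h N n 0 s) (\<lambda>s. (-1) ^ n * vv h N n 0 s) p"
proof (induction n arbitrary: p)
  case (Suc n)
  show ?case
    using dirac_cong[OF Suc.IH Suc.prems] by (simp add: dirac_wave[OF h N Suc.prems] del: uu.simps vv.simps)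
qed (simp add: g)

text \<open>The sign from the \<open>n\<close> Dirac operators cancels that of
  \<open>(- p 0) ^ n\<close>, so the CK series is the Taylor series of
  \<open>uu_vv_Taylor\<close>.\<close>

lemma CK_sums:
  assumes h: "h holomorphic_on ball 0 1" and N: "m + 2 * k = 2 * N + 1"
    and g: "\<And>q. vdom 0 (rsq m q) \<Longrightarrow> g q = radial (uu h N 0 0) (vv h N 0 0) q"
    and p: "wave_dom p"
  shows "(\<lambda>n. (- p 0) ^ n / fact n * (dirac m ^^ n) g p C) sums wave_field 1 h N 0 p C"
proof -
  have p': "vdom (p 0) (rsq m p)" using p by (simp add: wave_dom_def)
  have sgn: "(- p 0) ^ n * (-1) ^ n = p 0 ^ n" for n
    by (simp add: power_mult_distrib[symmetric])
  have "(- p 0) ^ n / fact n * (dirac m ^^ n) g p C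
      = uu h N n 0 (rsq m p) * p 0 ^ n / fact n * P p C + vv h N n 0 (rsq m p) * p 0 ^ n / fact n * X p C" for n
  proof -
    have "(dirac m ^^ n) g p = radial (\<lambda>s. (-1) ^ n * uu h N n 0 s) (\<lambda>s. (-1) ^ n * vv h N n 0 s) p"
      by (rule dirac_iterate_wave[OF h N g vdom_0[OF p']])
    then show ?thesis
      unfolding sgn[of n, symmetric] by (simp add: radial_apply[of _ _ p C] algebra_simps add_divide_distrib)
  qed
  moreover have "(\<lambda>n. uu h N n 0 (rsq m p) * p 0 ^ n / fact n * P p C + vv h N n 0 (rsq m p) * p 0 ^ n / fact n * X p C)
      sums (uu h N 0 (p 0) (rsq m p) * P p C + vv h N 0 (p 0) (rsq m p) * X p C)"
    using uu_vv_Taylor[OF h p', of N 0] by (intro sums_add sums_mult2) simp_all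
  ultimately show ?thesis
    by (simp add: wave_field_def radial_apply del: uu.simps vv.simps)
qed

end

section \<open>Numerical constants and the neighbourhood estimate\<close>

lemma dfact_even: "dfact (2 * n) = 2 ^ n * fact n"
  by (induction n) (simp_all add: algebra_simps)

lemma prod_four_diff: "(\<Prod>i<N. 4 * (real N - real i)) = 4 ^ N * fact N"
proof -
  have "(\<Prod>i<N. 4 * (real N - real i)) = (\<Prod>i<N. 4 * real (Suc (N - Suc i)))"
    by (intro prod.cong) (auto simp: of_nat_diff)
  also have "\<dots> = (\<Prod>i<N. 4 * real (Suc i))"
    by (rule prod.nat_diff_reindex)
  also have "\<dots> = 4 ^ N * fact N"
    by (induction N) (simp_all add: algebra_simps)
  finally show ?thesis .
qed

lemma prod_shift_descending: "(\<Prod>j<N. \<alpha> + real N - real j) = (\<Prod>j=1..N. \<alpha> + real j)"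
proof -
  have "(\<Prod>j<N. \<alpha> + real N - real j) = (\<Prod>j<N. \<alpha> + real (Suc (N - Suc j)))"
    by (intro prod.cong) (auto simp: of_nat_diff)
  also have "\<dots> = (\<Prod>j<N. \<alpha> + real (Suc j))"
    by (rule prod.nat_diff_reindex)
  also have "\<dots> = (\<Prod>j=1..N. \<alpha> + real j)"
    by (simp add: One_nat_def prod.atLeast1_atMost_eq)
  finally show ?thesis .
qed

text \<open>The time and spatial distances are at most the full distance, and the triangle
  inequality, used in both directions, bounds the change of radius by the spatial one.\<close>

lemma rad_close:
  assumes "(\<Sum>j\<in>{0..m}. (p j - x j)\<^sup>2) < \<epsilon>\<^sup>2" "\<epsilon> > 0"
  shows "\<bar>p 0 - x 0\<bar> < \<epsilon>" and "\<bar>rad m p - rad m x\<bar> < \<epsilon>"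
proof -
  have split: "(\<Sum>j\<in>{0..m}. (p j - x j)\<^sup>2) = (p 0 - x 0)\<^sup>2 + (\<Sum>j\<in>{1..m}. (p j - x j)\<^sup>2)"
  proof -
    have "{0..m} = insert 0 {1..m}" by auto
    then show ?thesis by simp
  qed
  have nonneg: "(\<Sum>j\<in>{1..m}. (p j - x j)\<^sup>2) \<ge> 0" by (simp add: sum_nonneg)
  have "(p 0 - x 0)\<^sup>2 < \<epsilon>\<^sup>2" using assms split nonneg by linarith
  then show "\<bar>p 0 - x 0\<bar> < \<epsilon>" using assms(2) by (metis abs_of_pos power2_less_imp_less power2_abs less_imp_le)
  have "(\<Sum>j\<in>{1..m}. (p j - x j)\<^sup>2) < \<epsilon>\<^sup>2"
    using assms split zero_le_power2[of "p 0 - x 0"] by linarith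
  then have d: "L2_set (\<lambda>j. p j - x j) {1..m} < \<epsilon>"
    using assms(2) unfolding L2_set_def by (simp add: real_sqrt_less_iff real_less_lsqrt)
  have d': "L2_set (\<lambda>j. x j - p j) {1..m} = L2_set (\<lambda>j. p j - x j) {1..m}"
    by (simp add: L2_set_def power2_commute)
  have "rad m p \<le> L2_set (\<lambda>j. p j - x j) {1..m} + rad m x"
    using L2_set_triangle_ineq[of "\<lambda>j. p j - x j" x "{1..m}"] by (simp add: rad_def L2_set_def)
  moreover have "rad m x \<le> L2_set (\<lambda>j. x j - p j) {1..m} + rad m p"
    using L2_set_triangle_ineq[of "\<lambda>j. x j - p j" p "{1..m}"] by (simp add: rad_def L2_set_def)
  ultimately show "\<bar>rad m p - rad m x\<bar> < \<epsilon>"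
    using d d' by linarith
qed

section \<open>Comparison of the Fueter image with the CK extension\<close>

theorem theorem2:
  fixes m k :: nat and \<alpha> :: real and P :: "(nat \<Rightarrow> real) \<Rightarrow> cliff"
  assumes "odd m"
    and "hom_poly m k P"
    and "\<And>x. dirac m P x = (\<lambda>C. 0)"
  shows "\<forall>x. 0 < rad m x \<and> rad m x < 1 \<and> x 0 = 0 \<longrightarrow>
     (\<exists>\<epsilon>>0. \<forall>p. (\<Sum>j\<in>{0..m}. (p j - x j)\<^sup>2) < \<epsilon>\<^sup>2 \<longrightarrow>
        (\<forall>C. summable (\<lambda>n. (- p 0) ^ n / fact n *
                 ((dirac m ^^ n) (\<lambda>y. cmul (cscal ((1 - (rad m y)\<^sup>2) powr \<alpha>)) (P y)) p) C)) \<and>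
        Ft m k (\<lambda>z. (1 + z\<^sup>2) powr (complex_of_real (\<alpha> + real (k + (m - 1) div 2)))) P p
        = (\<lambda>C. (-2) ^ (k + (m - 1) div 2) * real (dfact (2 * k + m - 1))
                 * (\<Prod>j=1..k + (m - 1) div 2. \<alpha> + real j)
                 * CK m (\<lambda>y. cmul (cscal ((1 - (rad m y)\<^sup>2) powr \<alpha>)) (P y)) p C))"
proof -
  obtain P1 P2 where "monogenic_poly m k P P1 P2"
    using hom_poly_monogenic_poly[OF assms(2,3)] by blast
  then interpret monogenic_poly m k P P1 P2 .
  define N where "N = k + (m - 1) div 2"
  \<comment> \<open>Oddness of \<open>m\<close> makes the truncated division exact.\<close>
  have N: "m + 2 * k = 2 * N + 1"
    using assms(1) unfolding N_def by presburger
  define g where "g = (\<lambda>y. cmul (cscal ((1 - (rad m y)\<^sup>2) powr \<alpha>)) (P y))"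
  have g: "g y = radial (\<lambda>s. (1 - s) powr \<alpha>) (\<lambda>_. 0) y" for y
    by (simp add: g_def cmul_cscal rad_power2 radial_def)
  define \<gamma> where "\<gamma> = complex_of_real (\<alpha> + real N)"
  define h where "h = (\<lambda>z. (1 + z\<^sup>2) powr \<gamma>)"
  \<comment> \<open>The \<open>N\<close>-th derivative of (1 - s)^(\<alpha> + N) is
    \<open>\<kappa>\<close> times (1 - s)^\<alpha>.\<close>
  define \<kappa> where "\<kappa> = (-1) ^ N * (\<Prod>j=1..N. \<alpha> + real j)"

  have h: "h holomorphic_on ball 0 1"
    unfolding h_def by (rule square_holomorphic[OF powr_holomorphic])
  have h0: "uu h N 0 0 s = \<kappa> * (1 - s) powr \<alpha>" "vv h N 0 0 s = 0" if "vdom 0 s" for s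
  proof -
    have s: "0 < s" "s < 1" using that by (auto simp: vdom_0_iff)
    have real: "(1 + - complex_of_real s) powr complex_of_real c = complex_of_real ((1 - s) powr c)"
      if "0 < s" "s < 1" for s c
      using powr_real[of "- s" c] that by simp
    have "(1 + - complex_of_real s) powr \<gamma> \<in> \<real>" if "0 < s" "s < 1" for s
      unfolding \<gamma>_def real[OF that] by simp
    note init = uu_vv_square_initial[OF powr_holomorphic[of \<gamma>] this s, folded h_def, of N]
    have "(\<Prod>j<N. \<gamma> - of_nat j) = complex_of_real (\<Prod>j=1..N. \<alpha> + real j)"
      by (simp add: \<gamma>_def prod_shift_descending[symmetric])
    moreover have "\<gamma> - of_nat N = complex_of_real \<alpha>" by (simp add: \<gamma>_def)
    ultimately have "(deriv ^^ N) (\<lambda>z. (1 + z) powr \<gamma>) (- complex_of_real s)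
        = complex_of_real ((\<Prod>j=1..N. \<alpha> + real j) * (1 - s) powr \<alpha>)"
      using s by (subst higher_deriv_powr) (simp_all add: real[OF s, simplified])
    with init(1) show "uu h N 0 0 s = \<kappa> * (1 - s) powr \<alpha>"
      by (simp only: \<kappa>_def Re_complex_of_real mult.assoc)
    show "vv h N 0 0 s = 0" by (rule init(2))
  qed

  \<comment> \<open>The factor \<open>(-1) ^ N\<close> compensates the one produced by
    differentiating q(-s) \<open>N\<close> times; reality of \<open>q\<close> on the axis will give
    zero initial values for \<open>vv\<close>.\<close>
  have "(\<lambda>w. (-1) ^ N * (1 + w) powr complex_of_real \<alpha>) holomorphic_on ball 0 1"
    by (intro holomorphic_intros powr_holomorphic)
  moreover have "(-1) ^ N * (1 + complex_of_real x) powr complex_of_real \<alpha> \<in> \<real>" if "\<bar>x\<bar> < 1" for x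
    unfolding powr_real[OF that] by (intro Reals_mult Reals_power Reals_of_real) simp
  ultimately obtain q where q: "q holomorphic_on ball 0 1"
    and q_real: "\<And>x. \<bar>x\<bar> < 1 \<Longrightarrow> q (complex_of_real x) \<in> \<real>"
    and q_deriv: "\<And>z. z \<in> ball 0 1 \<Longrightarrow> (deriv ^^ N) q z = (-1) ^ N * (1 + z) powr complex_of_real \<alpha>"
    using real_iterated_primitive[of _ N] by blast
  \<comment> \<open>The constant \<open>\<kappa>\<close> may vanish, so the summability of the CK series cannot be read off from \<open>h\<close>;
    \<open>f\<close> has the initial value \<open>(1 - s)\<^sup>\<alpha>\<close> itself.\<close>
  define f where "f = (\<lambda>z. q (z\<^sup>2))"
  have f: "f holomorphic_on ball 0 1"
    unfolding f_def by (rule square_holomorphic[OF q])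
  have f0: "uu f N 0 0 s = (1 - s) powr \<alpha>" "vv f N 0 0 s = 0" if "vdom 0 s" for s
  proof -
    have s: "0 < s" "s < 1" using that by (auto simp: vdom_0_iff)
    have "q (- complex_of_real s) \<in> \<real>" if "0 < s" "s < 1" for s
      using q_real[of "- s"] that by simp
    note init = uu_vv_square_initial[OF q this s, folded f_def, of N]
    have "(deriv ^^ N) q (- complex_of_real s) = complex_of_real ((-1) ^ N * (1 - s) powr \<alpha>)"
      using q_deriv[of "- complex_of_real s"] powr_real[of "- s" \<alpha>] s by simp
    with init(1) show "uu f N 0 0 s = (1 - s) powr \<alpha>"
      by (simp only: Re_complex_of_real) (simp add: mult.assoc[symmetric] power_mult_distrib[symmetric])
    show "vv f N 0 0 s = 0" by (rule init(2))
  qed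

  \<comment> \<open>Proportional initial values give proportional Taylor coefficients in
    \<open>t\<close>, hence proportional functions for all admissible \<open>t\<close>.\<close>
  have Taylor_eq: "uu h N 0 t s = \<kappa> * uu f N 0 t s" "vv h N 0 t s = \<kappa> * vv f N 0 t s" if ts: "vdom t s" for t s
  proof -
    have u: "uu h N l 0 s = \<kappa> * uu f N l 0 s" for l
      using uu_vv_initial_cong(1)[OF h f _ _ vdom_0[OF ts]] h0 f0 by simp
    have v: "vv h N l 0 s = \<kappa> * vv f N l 0 s" for l
      using uu_vv_initial_cong(2)[OF h f _ _ vdom_0[OF ts]] h0 f0 by simp
    show "uu h N 0 t s = \<kappa> * uu f N 0 t s"
      using uu_vv_Taylor(1)[OF h ts, of N 0] sums_mult[OF uu_vv_Taylor(1)[OF f ts, of N 0], of \<kappa>]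
      by (simp add: u mult.assoc sums_unique2)
    show "vv h N 0 t s = \<kappa> * vv f N 0 t s"
      using uu_vv_Taylor(2)[OF h ts, of N 0] sums_mult[OF uu_vv_Taylor(2)[OF f ts, of N 0], of \<kappa>]
      by (simp add: v mult.assoc sums_unique2)
  qed

  \<comment> \<open>Since 2k + m - 1 = 2N, the double factorial is 2^N N!, and 4^N (-1)^N = (-2)^N
    2^N.\<close>
  have const: "(\<Prod>i<N. 4 * (real N - real i)) * \<kappa>
      = (-2) ^ N * real (dfact (2 * k + m - 1)) * (\<Prod>j=1..N. \<alpha> + real j)"
  proof -
    have "2 * k + m - 1 = 2 * N" using N by simp
    then have "real (dfact (2 * k + m - 1)) = 2 ^ N * fact N"
      by (simp only: dfact_even) simp
    moreover have "(-2) ^ N * (2::real) ^ N = 4 ^ N * (-1) ^ N"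
      by (simp add: power_mult_distrib[symmetric])
    then have "(-2) ^ N * (2 ^ N * fact N) = 4 ^ N * (-1) ^ N * (fact N :: real)"
      by (simp only: mult.assoc[symmetric])
    ultimately show ?thesis
      unfolding prod_four_diff \<kappa>_def by (simp only: mult_ac)
  qed

  have main: "(\<forall>C. summable (\<lambda>n. (- p 0) ^ n / fact n * ((dirac m ^^ n) g p) C)) \<and>
      Ft m k h P p = (\<lambda>C. (-2) ^ N * real (dfact (2 * k + m - 1)) * (\<Prod>j=1..N. \<alpha> + real j) * CK m g p C)"
    if p: "wave_dom p" for p
  proof -
    have "g y = radial (uu f N 0 0) (vv f N 0 0) y" if "vdom 0 (rsq m y)" for y
      using f0[OF that] by (simp add: g radial_def del: uu.simps vv.simps)
    then have sums: "(\<lambda>n. (- p 0) ^ n / fact n * (dirac m ^^ n) g p C) sums wave_field 1 f N 0 p C" for C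
      using CK_sums[OF f N _ p] by blast
    then have CK: "CK m g p = wave_field 1 f N 0 p"
      by (auto simp: CK_def fun_eq_iff dest: sums_unique[symmetric])
    \<comment> \<open>The Fueter image is computed from \<open>h\<close> and the CK series from
      \<open>f\<close>; \<open>Taylor_eq\<close> links the two.\<close>
    have "Ft m k h P p = (\<lambda>C. (\<Prod>i<N. 4 * (real N - real i)) * \<kappa> * wave_field 1 f N 0 p C)"
      using p unfolding Ft_eq[OF h N p] wave_field_def radial_def wave_dom_def
      by (simp add: Taylor_eq algebra_simps del: uu.simps vv.simps)
    then show ?thesis
      using sums unfolding const CK by (blast intro: sums_summable)
  qed

  have near: "\<exists>\<epsilon>>0. \<forall>p. (\<Sum>j\<in>{0..m}. (p j - x j)\<^sup>2) < \<epsilon>\<^sup>2 \<longrightarrow> wave_dom p"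
    if x: "0 < rad m x" "rad m x < 1" "x 0 = 0" for x
  proof -
    \<comment> \<open>The first bound keeps the radius of \<open>p\<close> positive. The second
      leaves room for two errors, one in \<open>p 0\<close> and one in the radius, before their sum
      reaches 1.\<close>
    define \<epsilon> where "\<epsilon> = min (rad m x) ((1 - rad m x) / 2)"
    have \<epsilon>: "\<epsilon> \<le> rad m x" "\<epsilon> \<le> (1 - rad m x) / 2" unfolding \<epsilon>_def by linarith+
    have "\<epsilon> > 0" using x by (simp add: \<epsilon>_def)
    moreover have "wave_dom p" if "(\<Sum>j\<in>{0..m}. (p j - x j)\<^sup>2) < \<epsilon>\<^sup>2" for p
    proof -
      have "\<bar>p 0\<bar> < \<epsilon>" "rad m x < rad m p + \<epsilon>" "rad m p < rad m x + \<epsilon>"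
        using rad_close[OF that \<open>\<epsilon> > 0\<close>] x(3) by (simp_all add: abs_diff_less_iff)
      then have "\<bar>p 0\<bar> + rad m p < 1 \<and> 0 < rad m p"
        using \<epsilon> by (simp add: field_simps)
      then show ?thesis by (simp add: wave_dom_def vdom_def rad_eq_sqrt)
    qed
    ultimately show ?thesis by blast
  qed
  show ?thesis
  proof (intro allI impI)
    fix x assume "0 < rad m x \<and> rad m x < 1 \<and> x 0 = 0"
    then obtain \<epsilon> where \<epsilon>: "\<epsilon> > 0" "\<forall>p. (\<Sum>j\<in>{0..m}. (p j - x j)\<^sup>2) < \<epsilon>\<^sup>2 \<longrightarrow> wave_dom p"
      using near by blast
    show "\<exists>\<epsilon>>0. \<forall>p. (\<Sum>j\<in>{0..m}. (p j - x j)\<^sup>2) < \<epsilon>\<^sup>2 \<longrightarrow>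
        (\<forall>C. summable (\<lambda>n. (- p 0) ^ n / fact n *
                 ((dirac m ^^ n) (\<lambda>y. cmul (cscal ((1 - (rad m y)\<^sup>2) powr \<alpha>)) (P y)) p) C)) \<and>
        Ft m k (\<lambda>z. (1 + z\<^sup>2) powr (complex_of_real (\<alpha> + real (k + (m - 1) div 2)))) P p
        = (\<lambda>C. (-2) ^ (k + (m - 1) div 2) * real (dfact (2 * k + m - 1))
                 * (\<Prod>j=1..k + (m - 1) div 2. \<alpha> + real j)
                 * CK m (\<lambda>y. cmul (cscal ((1 - (rad m y)\<^sup>2) powr \<alpha>)) (P y)) p C)"
      by (intro exI[of _ \<epsilon>] conjI[OF \<epsilon>(1)] allI impI main[unfolded g_def h_def \<gamma>_def N_def])
        (rule \<epsilon>(2)[rule_format])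
  qed
qed

end
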